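(* Let $\kappa$ be an uncountable regular cardinal. A compact space is $\kappa$-Corson if and only if it has Property $\mathfrak{B}_\kappa$.
   Context: Compact spaces are Hausdorff. For a set $S$, $\Sigma_\kappa(S) = \{x \in [0,1]^S : |\mathrm{supp}(x)| < \kappa\}$ with the pointwise (product) topology, where $\mathrm{supp}(x) = \{\alpha \in S : x(\alpha) \neq 0\}$. A compact space is $\kappa$-Corson if it is topologically embeddable in $\Sigma_\kappa(S)$ for some set $S$. $H(\theta)$ is the set of all sets whose transitive closure has cardinality $<\theta$. An elementary submodel $M$ of $\langle H(\theta), \in\rangle$ is $\kappa$-stable if $\kappa \in M$ and $\kappa \cap M$ is an initial segment of $\kappa$. For a topological space $K$, "$K \in M$" means that both the set $K$ and a base of its topology are elements of $M$. $C(K)$ is the set of continuous real-valued functions on $K$. Given a compact space $K \in M$, define the equivalence relation $\sim_M$ on $K$ by: $x \sim_M y$ iff $f(x) = f(y)$ for every $f \in C(K) \cap M$. A compact space $K$ has Property $\mathfrak{B}_\kappa$ if for every big enough regular cardinal $\theta$ (i.e. for all sufficiently large regular $\theta$), for every $\kappa$-stable elementary submodel $M$ of $\langle H(\theta), \in\rangle$ such that $K \in M$ and $|M| < \kappa$, the relation $\sim_M$ is one-to-one on $\mathrm{cl}(K \cap M)$, i.e. any two distinct points $x,y \in \mathrm{cl}(K \cap M)$ satisfy $x \not\sim_M y$. *)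

theory Defs
  imports "HOL-Analysis.Analysis" "HOL-Library.Equipollence"
begin

section \<open>The set-theoretic universe\<close>

text \<open>
  The theorem quantifies over all regular cardinals \<open>\<theta>\<close> and over the structures
  \<open>\<langle>H(\<theta>), \<in>\<rangle>\<close>, so it lives in a universe of sets. Such a universe is a type whose elements
  are the (hereditary) sets; \<open>elts x\<close> is the collection of the members of \<open>x\<close>, and membership of
  \<open>x\<close> in \<open>y\<close> is \<open>x \<in> elts y\<close>. A collection is a set iff it lies in \<open>range elts\<close>. The
  assumptions are the ZF axioms (Pairing is derivable); Choice is inherited from HOL.
\<close>

class zfc_universe =
  fixes elts :: "'a \<Rightarrow> 'a set"
  assumes extensionality: "elts x = elts y \<Longrightarrow> x = y"
    and separation: "Y \<subseteq> elts x \<Longrightarrow> Y \<in> range elts"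
    and union_ax: "X \<in> range elts \<Longrightarrow> \<Union> (elts ` X) \<in> range elts"
    and power_ax: "X \<in> range elts \<Longrightarrow> {y. elts y \<subseteq> X} \<in> range elts"
    and replacement: "X \<in> range elts \<Longrightarrow> f ` X \<in> range elts"
    and infinity: "range (g :: nat \<Rightarrow> 'a) \<in> range elts"
    and foundation: "wf {(x, y). x \<in> elts y}"

text \<open>Junk unless \<open>X\<close> is in \<open>range elts\<close>.\<close>

definition vset :: "'v set \<Rightarrow> 'v::zfc_universe" where
  "vset X = inv elts X"

lemma elts_vset: "X \<in> range elts \<Longrightarrow> elts (vset X) = X"
  by (simp add: vset_def f_inv_into_f)

lemma countable_is_set:
  fixes X :: "'v::zfc_universe set"
  assumes "countable X" shows "X \<in> range elts"
proof (cases "X = {}")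
  case True
  then show ?thesis using separation[of "{}" undefined] by simp
next
  case False
  then show ?thesis using infinity[of "from_nat_into X"] assms
    by (simp add: range_from_nat_into)
qed

section \<open>Cardinals\<close>

text \<open>Ordinals are von Neumann ordinals, cardinals are initial ordinals.\<close>

definition transitive_set :: "'v::zfc_universe \<Rightarrow> bool" where
  "transitive_set x \<longleftrightarrow> (\<forall>y\<in>elts x. elts y \<subseteq> elts x)"

definition ordinal :: "'v::zfc_universe \<Rightarrow> bool" where
  "ordinal \<alpha> \<longleftrightarrow> transitive_set \<alpha> \<and> (\<forall>\<beta>\<in>elts \<alpha>. transitive_set \<beta>)"

definition cardinal :: "'v::zfc_universe \<Rightarrow> bool" where
  "cardinal \<kappa> \<longleftrightarrow> ordinal \<kappa> \<and> (\<forall>\<alpha>\<in>elts \<kappa>. elts \<alpha> \<prec> elts \<kappa>)"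

text \<open>An infinite cardinal in which every subset of smaller cardinality is bounded.\<close>

definition regular_cardinal :: "'v::zfc_universe \<Rightarrow> bool" where
  "regular_cardinal \<kappa> \<longleftrightarrow> cardinal \<kappa> \<and> infinite (elts \<kappa>) \<and>
     (\<forall>X \<subseteq> elts \<kappa>. X \<prec> elts \<kappa> \<longrightarrow> (\<exists>\<beta>\<in>elts \<kappa>. X \<subseteq> elts \<beta>))"

section \<open>Elementary submodels of \<open>H(\<theta>)\<close>\<close>

definition trans_closure :: "'v::zfc_universe \<Rightarrow> 'v set" where
  "trans_closure x = {y. (y, x) \<in> {(u, v). u \<in> elts v}\<^sup>+}"

definition Hset :: "'v::zfc_universe \<Rightarrow> 'v set" where
  "Hset \<theta> = {x. trans_closure x \<prec> elts \<theta>}"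

text \<open>
  First-order formulas of the language of set theory, with variables named by natural numbers,
  and Tarski satisfaction in the structure \<open>\<langle>A, \<in>\<rangle>\<close>.
\<close>

datatype fm = Mem nat nat | Eq nat nat | Neg fm | Conj fm fm | Exists nat fm

primrec sats :: "'v::zfc_universe set \<Rightarrow> fm \<Rightarrow> (nat \<Rightarrow> 'v) \<Rightarrow> bool" where
  "sats A (Mem i j) s \<longleftrightarrow> s i \<in> elts (s j)"
| "sats A (Eq i j) s \<longleftrightarrow> s i = s j"
| "sats A (Neg \<phi>) s \<longleftrightarrow> \<not> sats A \<phi> s"
| "sats A (Conj \<phi> \<psi>) s \<longleftrightarrow> sats A \<phi> s \<and> sats A \<psi> s"
| "sats A (Exists i \<phi>) s \<longleftrightarrow> (\<exists>a\<in>A. sats A \<phi> (s(i := a)))"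

definition elementary_submodel :: "'v::zfc_universe set \<Rightarrow> 'v set \<Rightarrow> bool" where
  "elementary_submodel M N \<longleftrightarrow> M \<noteq> {} \<and> M \<subseteq> N \<and>
     (\<forall>\<phi> s. range s \<subseteq> M \<longrightarrow> (sats M \<phi> s \<longleftrightarrow> sats N \<phi> s))"

definition stable_submodel :: "'v::zfc_universe \<Rightarrow> 'v \<Rightarrow> 'v set \<Rightarrow> bool" where
  "stable_submodel \<kappa> \<theta> M \<longleftrightarrow> elementary_submodel M (Hset \<theta>) \<and> \<kappa> \<in> M \<and>
     (\<forall>\<alpha> \<in> elts \<kappa> \<inter> M. elts \<alpha> \<subseteq> M)"

section \<open>Real-valued functions as sets\<close>

text \<open>
  For a real-valued function on \<open>K\<close> to be a candidate for membership in \<open>M\<close>, it has to be a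
  set: it is identified with its graph, a set of Kuratowski pairs, where reals are Dedekind cuts.
  A cut is taken on fractions \<open>(a - b) / (c + 1)\<close>, represented by triples of natural numbers.
\<close>

definition vpair :: "'v \<Rightarrow> 'v \<Rightarrow> 'v::zfc_universe" where
  "vpair x y = vset {vset {x}, vset {x, y}}"

primrec vnat :: "nat \<Rightarrow> 'v::zfc_universe" where
  "vnat 0 = vset {}"
| "vnat (Suc n) = vset (insert (vnat n) (elts (vnat n)))"

definition vreal :: "real \<Rightarrow> 'v::zfc_universe" where
  "vreal r = vset {vpair (vnat a) (vpair (vnat b) (vnat c)) | a b c.
                     (real a - real b) / real (Suc c) < r}"

definition vgraph :: "'v \<Rightarrow> ('v \<Rightarrow> real) \<Rightarrow> 'v::zfc_universe" where
  "vgraph K g = vset {vpair x (vreal (g x)) | x. x \<in> elts K}"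

text \<open>These codings are faithful.\<close>

lemma vpair_inject: "vpair x y = vpair x' y' \<longleftrightarrow> x = x' \<and> y = y'"
proof -
  have e: "elts (vset {a, b}) = {a, b}" "elts (vset {a}) = {a}" for a b :: 'a
    by (simp_all add: elts_vset countable_is_set)
  have "vset {a, b} = vset {c, d} \<longleftrightarrow> {a, b} = {c, d}"
    and "vset {a} = vset {c} \<longleftrightarrow> a = c"
    and "vset {a} = vset {c, d} \<longleftrightarrow> a = c \<and> a = d"
    and "vset {c, d} = vset {a} \<longleftrightarrow> a = c \<and> a = d" for a b c d :: 'a
    by (metis e doubleton_eq_iff insert_absorb2)+
  then show ?thesis unfolding vpair_def
    by (auto simp: doubleton_eq_iff)
qed

lemma elts_vnat: "elts (vnat n) = vnat ` {..<n}"
proof (induction n)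
  case 0
  then show ?case by (simp add: elts_vset countable_is_set)
next
  case (Suc n)
  then show ?case by (simp add: elts_vset countable_is_set lessThan_Suc)
qed

lemma vnat_inject: "vnat m = vnat n \<longleftrightarrow> m = n"
proof -
  have irr: "x \<notin> elts x" for x :: 'a
    using wf_irrefl[OF foundation] by auto
  have "vnat m \<noteq> (vnat n :: 'a)" if "m < n" for m n
    using that irr[of "vnat n"] elts_vnat[of n] by (metis imageI lessThan_iff)
  then show ?thesis by (metis linorder_neqE_nat)
qed

lemma elts_vreal:
  "elts (vreal r) = {vpair (vnat a) (vpair (vnat b) (vnat c)) | a b c.
                       (real a - real b) / real (Suc c) < r}"
proof -
  let ?f = "\<lambda>(a, b, c). vpair (vnat a) (vpair (vnat b) (vnat c)) :: 'a"
  have "{vpair (vnat a) (vpair (vnat b) (vnat c)) | a b c.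
          (real a - real b) / real (Suc c) < r} \<subseteq> range ?f"
    by (force intro: range_eqI[of _ ?f "(a, b, c)" for a b c])
  then have "countable {vpair (vnat a) (vpair (vnat b) (vnat c) :: 'a) | a b c.
          (real a - real b) / real (Suc c) < r}"
    by (rule countable_subset) simp
  then show ?thesis unfolding vreal_def by (intro elts_vset countable_is_set)
qed

lemma vreal_inject: "vreal r = vreal s \<longleftrightarrow> r = s"
proof -
  have "vreal r \<noteq> (vreal s :: 'a)" if "r < s" for r s
  proof -
    obtain q where q: "r < of_rat q" "of_rat q < s"
      using of_rat_dense \<open>r < s\<close> by blast
    obtain i k where ik: "q = Fract i k" "k > 0"
      using quotient_of_unique[of q] by (metis Rat_cases)
    have qq: "of_rat q = (real (nat i) - real (nat (- i))) / real (Suc (nat (k - 1)))"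
      using ik by (simp add: of_rat_rat)
    let ?x = "vpair (vnat (nat i)) (vpair (vnat (nat (- i))) (vnat (nat (k - 1)))) :: 'a"
    have "?x \<in> elts (vreal s)" using q qq unfolding elts_vreal by auto
    moreover have "?x \<notin> elts (vreal r)"
      using q qq unfolding elts_vreal by (auto simp: vpair_inject vnat_inject)
    ultimately show ?thesis by metis
  qed
  then show ?thesis by (metis linorder_less_linear)
qed

lemma elts_vgraph: "elts (vgraph K g) = {vpair x (vreal (g x)) | x. x \<in> elts K}"
  unfolding vgraph_def
  using replacement[of "elts K" "\<lambda>x. vpair x (vreal (g x))"]
  by (intro elts_vset) (simp add: setcompr_eq_image)

section \<open>\<open>\<kappa>\<close>-Corson spaces and Property \<open>\<BB>\<^sub>\<kappa>\<close>\<close>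

definition Sigma_space :: "'v::zfc_universe \<Rightarrow> 'v \<Rightarrow> ('v \<Rightarrow> real) topology" where
  "Sigma_space \<kappa> S =
     subtopology (product_topology (\<lambda>_. top_of_set {0..1}) (elts S))
       {x. {\<alpha> \<in> elts S. x \<alpha> \<noteq> 0} \<prec> elts \<kappa>}"

definition kappa_Corson :: "'v::zfc_universe \<Rightarrow> 'v topology \<Rightarrow> bool" where
  "kappa_Corson \<kappa> T \<longleftrightarrow> compact_space T \<and> Hausdorff_space T \<and>
     (\<exists>S e. embedding_map T (Sigma_space \<kappa> S) e)"

definition space_in_model :: "'v::zfc_universe \<Rightarrow> 'v topology \<Rightarrow> 'v set \<Rightarrow> bool" where
  "space_in_model K T M \<longleftrightarrow> K \<in> M \<and>
     (\<exists>B\<in>M. openin T = arbitrary union_of (\<lambda>U. U \<in> elts ` elts B))"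

definition model_equiv :: "'v::zfc_universe \<Rightarrow> 'v topology \<Rightarrow> 'v set \<Rightarrow> 'v \<Rightarrow> 'v \<Rightarrow> bool" where
  "model_equiv K T M x y \<longleftrightarrow>
     (\<forall>f. continuous_map T euclideanreal f \<and> vgraph K f \<in> M \<longrightarrow> f x = f y)"

definition property_B :: "'v::zfc_universe \<Rightarrow> 'v \<Rightarrow> 'v topology \<Rightarrow> bool" where
  "property_B \<kappa> K T \<longleftrightarrow>
     (\<exists>\<theta>\<^sub>0. cardinal \<theta>\<^sub>0 \<and>
       (\<forall>\<theta>. regular_cardinal \<theta> \<and> elts \<theta>\<^sub>0 \<subseteq> elts \<theta> \<longrightarrow>
         (\<forall>M. stable_submodel \<kappa> \<theta> M \<and> space_in_model K T M \<and> M \<prec> elts \<kappa> \<longrightarrow>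
           (\<forall>x \<in> T closure_of (elts K \<inter> M). \<forall>y \<in> T closure_of (elts K \<inter> M).
              x \<noteq> y \<longrightarrow> \<not> model_equiv K T M x y))))"

end

theory Submission
  imports Defs
begin

text \<open>
  If \<open>K\<close> is \<open>\<kappa>\<close>-Corson, the graphs of the coordinate functions form a set with a definable property,
  so some such family \<open>F\<close> lies in \<open>M\<close>. For \<open>x \<in> K \<inter> M\<close> the fewer than \<open>\<kappa>\<close> members of \<open>F\<close> that do
  not vanish at \<open>x\<close> are enumerated in \<open>M\<close> by an ordinal in \<open>\<kappa> \<inter> M\<close>, hence belong to \<open>M\<close>. So the
  members of \<open>F\<close> outside \<open>M\<close> are constant on the closure of \<open>K \<inter> M\<close>, and points of this closure
  are separated by members of \<open>F \<inter> M\<close>.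

  Conversely, represent the models by sets \<open>X\<close> closed under Skolem functions. Applying the property
  to small models yields that \<open>\<sim>\<^sub>X\<close> is one-to-one on \<open>cl (K \<inter> X)\<close> for \<open>X\<close> of any size, hence a
  retraction \<open>r\<^sub>X\<close> of \<open>K\<close> onto \<open>cl (K \<inter> X)\<close>. Write \<open>X\<close> as the union of a continuous increasing chain
  of smaller models \<open>X\<^sub>m\<close>. For each \<open>x\<close> the retractions \<open>r\<^sub>m x\<close> change at fewer than \<open>\<kappa>\<close> stages.
  Hence the differences \<open>s \<circ> r\<^sub>m - s \<circ> r'\<^sub>m\<close>, with \<open>r'\<^sub>m\<close> the retraction before stage \<open>m\<close> and \<open>s\<close>
  ranging over separating families of the pieces obtained by induction on the cardinality, form a
  separating family for \<open>X\<close> in which fewer than \<open>\<kappa>\<close> functions are nonzero at each point.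
\<close>

text \<open>The obstacle in the converse is that Property B only speaks of models of size below
  \<kappa>, while an embedding needs one family for all of K. Large models are reached by
  reflection: a point of the closure of X already lies in the closure of a small closed subset of X,
  so a failure of separation in X would show up in a small model. The induction on cardinality then
  needs stages that grow continuously, which holds because every rule takes finitely many arguments.
  The two directions use elementarity in opposite ways. The converse needs only sets closed under
  enough operations to be elementary; further operations are added to the Skolem functions at will,
  and no concrete formula is ever written. The forward direction must find particular objects in M,
  so being the graph of a continuous function has to be expressed by a formula with parameters in M.
  As reals are cuts of fractions, this is the origin of the arithmetic inside M.\<close>

unbundle cardinal_syntax

section \<open>Closure systems and their cardinalities\<close>

section \<open>Sets of size below a regular cardinal\<close>

text \<open>The bound is an arbitrary \<open>r\<close> rather than \<kappa>, since
  \<open>large_generated\<close> uses the same facts for a successor cardinal.\<close>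

locale small_sets =
  fixes r :: "'r rel"
  assumes stable: "stable r" and nat_less: "|UNIV :: nat set| <o r"
begin

abbreviation small :: "'b set \<Rightarrow> bool" where
  "small A \<equiv> |A| <o r"

lemma small_lepoll: "A \<lesssim> B \<Longrightarrow> small B \<Longrightarrow> small A"
  by (auto simp: lepoll_def card_of_ordLeq intro: ordLeq_ordLess_trans)

lemma small_subset: "A \<subseteq> B \<Longrightarrow> small B \<Longrightarrow> small A"
  by (rule small_lepoll[OF subset_imp_lepoll])

lemma small_image: "small A \<Longrightarrow> small (f ` A)"
  by (rule small_lepoll[OF image_lepoll])

lemma small_countable: "countable A \<Longrightarrow> small A"
  using small_lepoll[OF _ nat_less] by (simp add: countable_def lepoll_def) blast

lemma small_UN: "small I \<Longrightarrow> (\<And>i. i \<in> I \<Longrightarrow> small (A i)) \<Longrightarrow> small (\<Union>i\<in>I. A i)"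
  using stable_UNION[OF stable] by blast

lemma small_Un: "small A \<Longrightarrow> small B \<Longrightarrow> small (A \<union> B)"
  using small_UN[of "UNIV :: bool set" "\<lambda>b. if b then A else B"]
  by (simp add: small_countable UNIV_bool Un_commute)

lemma small_lists:
  assumes "small A" shows "small (lists A)"
proof -
  have *: "small {xs \<in> lists A. length xs = n}" for n
  proof (induction n)
    case 0
    have "{xs \<in> lists A. length xs = 0} = {[]}" by auto
    then show ?case by (simp only: small_countable countable_finite finite.emptyI finite.insertI)
  next
    case (Suc n)
    have "{xs \<in> lists A. length xs = Suc n} = (\<Union>a\<in>A. Cons a ` {xs \<in> lists A. length xs = n})"
    proof (intro set_eqI iffI)
      fix xs assume "xs \<in> {xs \<in> lists A. length xs = Suc n}"
      then show "xs \<in> (\<Union>a\<in>A. Cons a ` {xs \<in> lists A. length xs = n})"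
        by (cases xs) auto
    qed auto
    then show ?case by (simp only: small_UN[OF assms small_image[OF Suc]])
  qed
  have "lists A = (\<Union>n. {xs \<in> lists A. length xs = n})" by auto
  moreover have "small (\<Union>n. {xs \<in> lists A. length xs = n})" by (rule small_UN[OF nat_less *])
  ultimately show ?thesis by (rule ssubst)
qed

end

section \<open>Finitary closure systems\<close>

text \<open>A rule yields a set instead of one element, so that a single rule can add all elements
  of an ordinal below \<kappa> or all countably many Skolem values. The empty list supplies
  constants.\<close>

definition rule_closed :: "('a list \<Rightarrow> 'a set) \<Rightarrow> 'a set \<Rightarrow> bool" where
  "rule_closed G X \<longleftrightarrow> (\<forall>xs. set xs \<subseteq> X \<longrightarrow> G xs \<subseteq> X)"

inductive_set generated :: "('a list \<Rightarrow> 'a set) \<Rightarrow> 'a set \<Rightarrow> 'a set"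
  for G :: "'a list \<Rightarrow> 'a set" and Y :: "'a set" where
  base: "a \<in> Y \<Longrightarrow> a \<in> generated G Y"
| step: "\<forall>x\<in>set xs. x \<in> generated G Y \<Longrightarrow> a \<in> G xs \<Longrightarrow> a \<in> generated G Y"

lemma rule_closed_generated: "rule_closed G (generated G Y)"
  unfolding rule_closed_def by (auto intro: generated.step)

lemma generated_least:
  assumes "rule_closed G X" "Y \<subseteq> X" shows "generated G Y \<subseteq> X"
proof
  fix a assume "a \<in> generated G Y"
  then show "a \<in> X"
    by induction (use assms in \<open>auto simp: rule_closed_def\<close>)
qed

lemma generated_superset: "Y \<subseteq> generated G Y"
  by (auto intro: generated.base)

lemma generated_mono: "Y \<subseteq> Z \<Longrightarrow> generated G Y \<subseteq> generated G Z"
  by (rule generated_least[OF rule_closed_generated]) (auto intro: generated.base)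

lemma generated_finitary:
  "a \<in> generated G Y \<Longrightarrow> \<exists>F. finite F \<and> F \<subseteq> Y \<and> a \<in> generated G F"
proof (induction rule: generated.induct)
  case (base a)
  then show ?case by (intro exI[of _ "{a}"]) (auto intro: generated.base)
next
  case (step xs a)
  then have "\<forall>x\<in>set xs. \<exists>F. finite F \<and> F \<subseteq> Y \<and> x \<in> generated G F" by blast
  then obtain F where F: "\<And>x. x \<in> set xs \<Longrightarrow> finite (F x) \<and> F x \<subseteq> Y \<and> x \<in> generated G (F x)"
    by metis
  let ?F = "\<Union>x\<in>set xs. F x"
  have "\<forall>x\<in>set xs. x \<in> generated G ?F"
    using F generated_mono[of "F _" ?F G] by (meson UN_upper subsetD)
  then show ?case using F step(2) by (intro exI[of _ ?F]) (auto intro: generated.step)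
qed

lemma rule_closed_Int: "rule_closed G X \<Longrightarrow> rule_closed G Y \<Longrightarrow> rule_closed G (X \<inter> Y)"
  by (auto simp: rule_closed_def)

text \<open>Argument lists are finite, so each list lies in one of the stages
  \<open>(st ^^ n) Y\<close> and the closure is complete after countably many steps; since
  \<open>r\<close> is stable and above the cardinality of \<open>nat\<close>, the union stays
  small.\<close>

lemma (in small_sets) small_generated:
  assumes G: "\<And>xs. small (G xs)" and Y: "small Y"
  shows "small (generated G Y)"
proof -
  define st where "st Z = Z \<union> (\<Union>xs\<in>lists Z. G xs)" for Z
  have st: "small ((st ^^ n) Y)" for n
    by (induction n) (simp_all add: Y st_def small_Un small_UN small_lists G)
  have mono: "(st ^^ m) Y \<subseteq> (st ^^ n) Y" if "m \<le> n" for m n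
    using that by (induction rule: dec_induct) (auto simp: st_def)
  have "rule_closed G (\<Union>n. (st ^^ n) Y)"
    unfolding rule_closed_def
  proof (intro allI impI)
    fix xs assume "set xs \<subseteq> (\<Union>n. (st ^^ n) Y)"
    then have "\<exists>n. set xs \<subseteq> (st ^^ n) Y"
    proof (induction xs)
      case (Cons x xs)
      then obtain m n where "x \<in> (st ^^ m) Y" "set xs \<subseteq> (st ^^ n) Y" by auto
      then have "set (x # xs) \<subseteq> (st ^^ max m n) Y"
        using mono[of m "max m n"] mono[of n "max m n"] by auto
      then show ?case by blast
    qed auto
    then obtain n where "xs \<in> lists ((st ^^ n) Y)" by blast
    then have "G xs \<subseteq> (st ^^ Suc n) Y" by (auto simp: st_def)
    then show "G xs \<subseteq> (\<Union>n. (st ^^ n) Y)" by blast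
  qed
  then have "generated G Y \<subseteq> (\<Union>n. (st ^^ n) Y)"
    by (rule generated_least) (auto intro!: exI[of _ 0])
  then show ?thesis by (rule small_subset) (intro small_UN nat_less st)
qed

text \<open>This is \<open>small_generated\<close> for the successor cardinal of \<open>|Y|\<close>,
  below which lie exactly the sets of size at most \<open>|Y|\<close>.\<close>

lemma (in small_sets) large_generated:
  assumes G: "\<And>xs. small (G xs)" and Y: "r \<le>o |Y|"
  shows "|generated G Y| \<le>o |Y|"
proof -
  have inf: "infinite Y"
    using ordLess_ordLeq_trans[OF nat_less Y] by (simp add: infinite_iff_card_of_nat ordLess_imp_ordLeq)
  let ?s = "cardSuc |Y|"
  have less: "|A| <o ?s \<longleftrightarrow> |A| \<le>o |Y|" for A :: "'b set"
    by (rule cardSuc_ordLeq_ordLess) (rule card_of_Card_order)+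
  have "small_sets ?s"
  proof
    show "stable ?s"
    proof (rule regularCard_stable)
      show "Card_order ?s" by (rule cardSuc_Card_order[OF card_of_Card_order])
      show "infinite (Field ?s)" using inf by (simp add: card_of_cardSuc_finite)
      show "regularCard ?s"
        by (rule infinite_cardSuc_regularCard[OF _ card_of_Card_order]) (simp add: inf Field_card_of)
    qed
    show "|UNIV :: nat set| <o ?s"
      using ordLess_ordLeq_trans[OF nat_less Y] by (simp add: less ordLess_imp_ordLeq)
  qed
  then interpret s: small_sets ?s .
  show ?thesis unfolding less[symmetric]
  proof (rule s.small_generated)
    show "|G xs| <o ?s" for xs
      using ordLess_ordLeq_trans[OF G Y] by (simp add: less ordLess_imp_ordLeq)
    show "|Y| <o ?s" by (simp add: less card_of_mono1)
  qed
qed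

section \<open>Retractions and separating families, abstracted from set theory\<close>

section \<open>Retractions onto closures of models\<close>

text \<open>\<open>fn c\<close> is the real function coded by \<open>c\<close>.
  \<open>separation\<close> is what Property B gives, hence the restriction to small
  \<open>X\<close>; \<open>dense\<close> comes from closure under choices of points and holds for
  every size.\<close>

locale elementary_separation = small_sets r for r :: "'r rel" +
  fixes T :: "'a topology" and fn :: "'a \<Rightarrow> 'a \<Rightarrow> real" and G :: "'a list \<Rightarrow> 'a set"
  assumes Card_order: "Card_order r"
    and compact: "compact_space T" and Hausdorff: "Hausdorff_space T"
    and cont: "continuous_map T euclideanreal (fn c)"
    and small_G: "|G xs| <o r"
    and separation: "rule_closed G X \<Longrightarrow> |X| <o r \<Longrightarrow>
      x \<in> T closure_of (topspace T \<inter> X) \<Longrightarrow> y \<in> T closure_of (topspace T \<inter> X) \<Longrightarrow>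
      (\<And>c. c \<in> X \<Longrightarrow> fn c x = fn c y) \<Longrightarrow> x = y"
    and dense: "rule_closed G X \<Longrightarrow> x \<in> topspace T \<Longrightarrow> finite C \<Longrightarrow> C \<subseteq> X \<Longrightarrow> 0 < \<epsilon> \<Longrightarrow>
      \<exists>z\<in>topspace T \<inter> X. \<forall>c\<in>C. \<bar>fn c z - fn c x\<bar> < \<epsilon>"
begin

abbreviation cl :: "'a set \<Rightarrow> 'a set" where
  "cl X \<equiv> T closure_of (topspace T \<inter> X)"

lemma cl_topspace: "x \<in> cl X \<Longrightarrow> x \<in> topspace T"
  by (meson closure_of_subset_topspace subsetD)

lemma cl_mono: "X \<subseteq> Y \<Longrightarrow> cl X \<subseteq> cl Y"
  by (intro closure_of_mono) auto

lemma subset_cl: "x \<in> topspace T \<Longrightarrow> x \<in> X \<Longrightarrow> x \<in> cl X"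
  using closure_of_subset[of "topspace T \<inter> X" T] by auto

text \<open>Compactness: the approximations give the finite intersection property to the closed sets
  \<open>D p\<close> on which one function is within \<open>1 / (n + 1)\<close> of its
  target.\<close>

lemma closure_attains_limit_values:
  assumes A: "A \<subseteq> topspace T"
    and appr: "\<And>C \<epsilon>. finite C \<Longrightarrow> C \<subseteq> N \<Longrightarrow> 0 < \<epsilon> \<Longrightarrow> \<exists>z\<in>A. \<forall>c\<in>C. \<bar>fn c z - v c\<bar> < \<epsilon>"
  shows "\<exists>q\<in>T closure_of A. \<forall>c\<in>N. fn c q = v c"
proof -
  define D where "D p = {q \<in> T closure_of A. \<bar>fn (fst p) q - v (fst p)\<bar> \<le> 1 / real (Suc (snd p))}" for p
  \<comment> \<open>The closure itself is inserted so that the common point lies in it even when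
    \<open>N\<close> is empty.\<close>
  let ?U = "insert (T closure_of A) (D ` (N \<times> UNIV))"
  have "closedin T (D p)" for p
  proof -
    have "D p = T closure_of A \<inter> {q \<in> topspace T. fn (fst p) q \<in>
        {v (fst p) - 1 / real (Suc (snd p))..v (fst p) + 1 / real (Suc (snd p))}}"
      using closure_of_subset_topspace[of T A] by (auto simp: D_def abs_le_iff)
    also have "closedin T \<dots>"
      by (intro closedin_Int closedin_closure_of closedin_continuous_map_preimage[OF cont]) simp
    finally show ?thesis .
  qed
  then have "\<forall>C\<in>?U. closedin T C" by auto
  moreover have "\<Inter>F \<noteq> {}" if F: "finite F" "F \<subseteq> ?U" for F
  proof -
    have "F - {T closure_of A} \<subseteq> D ` (N \<times> UNIV)" "finite (F - {T closure_of A})"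
      using F by auto
    then obtain P where P: "P \<subseteq> N \<times> UNIV" "finite P" "F - {T closure_of A} = D ` P"
      by (meson finite_subset_image)
    define \<epsilon> where "\<epsilon> = Min (insert 1 ((\<lambda>p. 1 / real (Suc (snd p))) ` P))"
    have "0 < \<epsilon>" using P(2) by (auto simp: \<epsilon>_def)
    then obtain z where z: "z \<in> A" "\<forall>c\<in>fst ` P. \<bar>fn c z - v c\<bar> < \<epsilon>"
      using appr[of "fst ` P" \<epsilon>] P(1,2) by fastforce
    have zc: "z \<in> T closure_of A" using z(1) closure_of_subset[OF A] by blast
    have "z \<in> D p" if "p \<in> P" for p
    proof -
      have "\<epsilon> \<le> 1 / real (Suc (snd p))"
        using that P(2) unfolding \<epsilon>_def by (intro Min_le) auto
      then show ?thesis using z(2) that zc by (force simp: D_def)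
    qed
    then have "z \<in> \<Inter>F" using zc P(3) by blast
    then show ?thesis by blast
  qed
  ultimately have "\<Inter>?U \<noteq> {}"
    by (intro compact[unfolded compact_space_fip, THEN spec, THEN mp] conjI) simp_all
  then obtain q where q: "q \<in> T closure_of A" "\<And>c n. c \<in> N \<Longrightarrow> q \<in> D (c, n)" by auto
  have "fn c q = v c" if "c \<in> N" for c
  proof (rule ccontr)
    assume "fn c q \<noteq> v c"
    then have "0 < \<bar>fn c q - v c\<bar>" by simp
    then obtain n where "inverse (real (Suc n)) < \<bar>fn c q - v c\<bar>" using reals_Archimedean by blast
    then show False using q(2)[OF that, of n] by (simp add: D_def inverse_eq_divide)
  qed
  then show ?thesis using q(1) by blast
qed

text \<open>The approximations accumulate at a point of \<open>cl (X \<inter> N)\<close> where all functions coded in \<open>N\<close>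
  take the same values as at \<open>p\<close>; separation in \<open>N\<close> then forces it to be \<open>p\<close>.\<close>

lemma in_cl_trace:
  assumes N: "rule_closed G N" "small N" "p \<in> cl N"
    and appr: "\<And>cs n. set cs \<subseteq> N \<Longrightarrow>
      \<exists>z\<in>topspace T \<inter> X \<inter> N. \<forall>c\<in>set cs. \<bar>fn c z - fn c p\<bar> < 1 / real (Suc n)"
  shows "p \<in> cl (X \<inter> N)"
proof -
  have "\<exists>q\<in>cl (X \<inter> N). \<forall>c\<in>N. fn c q = fn c p"
  proof (rule closure_attains_limit_values)
    fix C \<epsilon> assume C: "finite C" "C \<subseteq> N" and "0 < (\<epsilon> :: real)"
    then obtain n where n: "inverse (real (Suc n)) < \<epsilon>" using reals_Archimedean by blast
    obtain cs where cs: "set cs = C" using C(1) finite_list by blast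
    then obtain z where z: "z \<in> topspace T \<inter> X \<inter> N"
      and "\<forall>c\<in>set cs. \<bar>fn c z - fn c p\<bar> < 1 / real (Suc n)"
      using appr[of cs n] C(2) by blast
    then have "\<forall>c\<in>C. \<bar>fn c z - fn c p\<bar> < \<epsilon>"
      using n unfolding cs inverse_eq_divide by (meson less_trans)
    with z show "\<exists>z\<in>topspace T \<inter> (X \<inter> N). \<forall>c\<in>C. \<bar>fn c z - fn c p\<bar> < \<epsilon>" by blast
  qed auto
  then obtain q where q: "q \<in> cl (X \<inter> N)" "\<forall>c\<in>N. fn c q = fn c p" by blast
  moreover have "q \<in> cl N" using q(1) cl_mono[of "X \<inter> N" N] by auto
  ultimately have "q = p" using separation[OF N(1,2) _ N(3)] by blast
  with q(1) show ?thesis by simp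
qed

text \<open>These choices will be added as rules; a small set closed under them contains all
  approximations that \<open>in_cl_trace\<close> asks for.\<close>

definition approx :: "'a set \<Rightarrow> 'a \<Rightarrow> 'a list \<Rightarrow> nat \<Rightarrow> 'a" where
  "approx X p cs n =
    (SOME z. z \<in> topspace T \<inter> X \<and> (\<forall>c\<in>set cs. \<bar>fn c z - fn c p\<bar> < 1 / real (Suc n)))"

lemma approx:
  assumes p: "p \<in> cl X"
  shows "approx X p cs n \<in> topspace T \<inter> X \<and>
    (\<forall>c\<in>set cs. \<bar>fn c (approx X p cs n) - fn c p\<bar> < 1 / real (Suc n))"
  unfolding approx_def
proof (rule someI_ex)
  let ?U = "\<lambda>c. {x \<in> topspace T. fn c x \<in> {fn c p - 1 / real (Suc n)<..<fn c p + 1 / real (Suc n)}}"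
  have "openin T (topspace T \<inter> \<Inter>(?U ` set cs))"
    by (intro openin_Int_Inter) (auto intro!: openin_continuous_map_preimage[OF cont] simp del: greaterThanLessThan_iff)
  moreover have "p \<in> topspace T \<inter> \<Inter>(?U ` set cs)" using cl_topspace[OF p] by auto
  ultimately obtain z where "z \<in> topspace T \<inter> X" "z \<in> topspace T \<inter> \<Inter>(?U ` set cs)"
    using p unfolding in_closure_of by blast
  then show "\<exists>z. z \<in> topspace T \<inter> X \<and> (\<forall>c\<in>set cs. \<bar>fn c z - fn c p\<bar> < 1 / real (Suc n))"
    by (intro exI[of _ z]) (auto simp: abs_less_iff)
qed

lemma in_cl_trace_approx:
  assumes N: "rule_closed G N" "small N" "p \<in> N" and p: "p \<in> cl X"
    and appr: "\<And>cs n. set cs \<subseteq> N \<Longrightarrow> approx X p cs n \<in> N"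
  shows "p \<in> cl (X \<inter> N)"
proof (rule in_cl_trace[OF N(1,2)])
  show "p \<in> cl N" using subset_cl[OF cl_topspace[OF p] N(3)] .
  show "\<exists>z\<in>topspace T \<inter> X \<inter> N. \<forall>c\<in>set cs. \<bar>fn c z - fn c p\<bar> < 1 / real (Suc n)"
    if "set cs \<subseteq> N" for cs n
    using appr[OF that, of n] approx[OF p, of cs n] by blast
qed

lemma rule_closed_Un_left: "rule_closed (\<lambda>xs. G xs \<union> G' xs) X \<Longrightarrow> rule_closed G X"
  by (auto simp: rule_closed_def)

text \<open>The closure \<open>N\<close> of \<open>{p}\<close> under \<open>G\<close> and the
  choices of approximations is small, and \<open>p\<close> lies in the closure of
  \<open>X \<inter> N\<close>. As an intersection of closed sets, \<open>X \<inter> N\<close> is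
  again closed under \<open>G\<close>.\<close>

lemma small_trace:
  assumes X: "rule_closed G X" and p: "p \<in> cl X"
  shows "\<exists>Y\<subseteq>X. rule_closed G Y \<and> small Y \<and> p \<in> cl Y"
proof -
  define G' where "G' cs = G cs \<union> range (approx X p cs)" for cs
  define N where "N = generated G' {p}"
  have N': "rule_closed G' N" unfolding N_def by (rule rule_closed_generated)
  then have N: "rule_closed G N" unfolding G'_def by (rule rule_closed_Un_left)
  have sN: "small N" unfolding N_def
    by (rule small_generated) (auto simp: G'_def intro: small_Un[OF small_G small_countable] small_countable)
  have "p \<in> cl (X \<inter> N)"
  proof (rule in_cl_trace_approx[OF N sN _ p])
    show "p \<in> N" unfolding N_def by (simp add: generated.base)
    show "approx X p cs n \<in> N" if "set cs \<subseteq> N" for cs n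
      using N' that unfolding rule_closed_def G'_def by blast
  qed
  moreover have "small (X \<inter> N)" by (rule small_subset[OF Int_lower2 sN])
  ultimately show ?thesis
    using rule_closed_Int[OF X N] by (meson Int_lower1)
qed

text \<open>Both points have small traces in \<open>X\<close>; the closed set generated by the two
  traces is still small and still inside \<open>X\<close>.\<close>

lemma separation_any_size:
  assumes X: "rule_closed G X" and x: "x \<in> cl X" and y: "y \<in> cl X"
    and eq: "\<And>c. c \<in> X \<Longrightarrow> fn c x = fn c y"
  shows "x = y"
proof -
  obtain Y1 Y2 where Y: "Y1 \<subseteq> X" "small Y1" "x \<in> cl Y1" "Y2 \<subseteq> X" "small Y2" "y \<in> cl Y2"
    using small_trace[OF X x] small_trace[OF X y] by blast
  let ?Y = "generated G (Y1 \<union> Y2)"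
  have "?Y \<subseteq> X" using Y by (intro generated_least[OF X]) auto
  moreover have "x \<in> cl ?Y" "y \<in> cl ?Y"
    using Y(3,6) cl_mono[of Y1 ?Y] cl_mono[of Y2 ?Y] generated_superset[of "Y1 \<union> Y2" G] by auto
  moreover have "small ?Y" using Y by (intro small_generated small_G small_Un)
  ultimately show ?thesis
    using eq by (intro separation[OF rule_closed_generated]) auto
qed

definition retr :: "'a set \<Rightarrow> 'a \<Rightarrow> 'a" where
  "retr X x = (THE y. y \<in> cl X \<and> (\<forall>c\<in>X. fn c y = fn c x))"

text \<open>Existence is density followed by compactness, uniqueness is separation for models of any
  size.\<close>

lemma retr_ex1:
  assumes X: "rule_closed G X" and x: "x \<in> topspace T"
  shows "\<exists>!y. y \<in> cl X \<and> (\<forall>c\<in>X. fn c y = fn c x)"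
proof -
  have "\<exists>y\<in>cl X. \<forall>c\<in>X. fn c y = fn c x"
    by (rule closure_attains_limit_values) (use dense[OF X x] in auto)
  then obtain y where y: "y \<in> cl X" "\<forall>c\<in>X. fn c y = fn c x" by blast
  show ?thesis
  proof (rule ex1I[of _ y])
    fix z assume "z \<in> cl X \<and> (\<forall>c\<in>X. fn c z = fn c x)"
    with y show "z = y" by (intro separation_any_size[OF X]) auto
  qed (use y in blast)
qed

lemma
  assumes "rule_closed G X" "x \<in> topspace T"
  shows retr_in_cl: "retr X x \<in> cl X" and retr_fn: "c \<in> X \<Longrightarrow> fn c (retr X x) = fn c x"
  using theI'[OF retr_ex1[OF assms]] unfolding retr_def by auto

lemma retr_topspace: "rule_closed G X \<Longrightarrow> x \<in> topspace T \<Longrightarrow> retr X x \<in> topspace T"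
  using retr_in_cl cl_topspace by blast

lemma retr_unique:
  assumes "rule_closed G X" "x \<in> topspace T" "y \<in> cl X" "\<And>c. c \<in> X \<Longrightarrow> fn c y = fn c x"
  shows "retr X x = y"
  unfolding retr_def using assms(3,4) by (intro the1_equality[OF retr_ex1[OF assms(1,2)]]) auto

lemma retr_eq_iff:
  assumes "rule_closed G X" "x \<in> topspace T" "y \<in> topspace T"
  shows "retr X x = retr X y \<longleftrightarrow> (\<forall>c\<in>X. fn c x = fn c y)"
proof
  assume "retr X x = retr X y"
  then show "\<forall>c\<in>X. fn c x = fn c y"
    using retr_fn[OF assms(1,2)] retr_fn[OF assms(1,3)] by fastforce
next
  assume "\<forall>c\<in>X. fn c x = fn c y"
  then show "retr X x = retr X y"
    using retr_fn[OF assms(1,3)] by (intro retr_unique[OF assms(1,2)] retr_in_cl[OF assms(1,3)]) simp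
qed

lemma retr_between:
  assumes "rule_closed G X" "rule_closed G Y" "X \<subseteq> Y" "x \<in> topspace T" "retr Y x \<in> cl X"
  shows "retr X x = retr Y x"
  using assms(3) retr_fn[OF assms(2,4)] by (intro retr_unique[OF assms(1,4,5)]) auto

text \<open>If \<open>p\<close> is in the closure of the preimage of a closed \<open>C\<close>, the
  images of nearby points of the preimage lie in \<open>C \<inter> cl X\<close> and approximate the
  values at \<open>p\<close>. A point of this closed set attaining these values must be
  \<open>retr X p\<close>.\<close>

lemma continuous_map_retr:
  assumes X: "rule_closed G X"
  shows "continuous_map T T (retr X)"
  unfolding continuous_map_closedin
proof (intro conjI allI impI ballI)
  fix C assume C: "closedin T C"
  let ?P = "{x \<in> topspace T. retr X x \<in> C}"
  have "T closure_of ?P \<subseteq> ?P"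
  proof
    fix p assume p: "p \<in> T closure_of ?P"
    then have pT: "p \<in> topspace T" by (simp add: in_closure_of)
    have "\<exists>q\<in>T closure_of (C \<inter> cl X). \<forall>c\<in>X. fn c q = fn c p"
    proof (rule closure_attains_limit_values)
      fix D \<epsilon> assume D: "finite D" "D \<subseteq> X" and \<epsilon>: "0 < (\<epsilon> :: real)"
      let ?U = "\<lambda>c. {x \<in> topspace T. fn c x \<in> {fn c p - \<epsilon><..<fn c p + \<epsilon>}}"
      have "openin T (topspace T \<inter> \<Inter>(?U ` D))"
        using D(1) by (intro openin_Int_Inter)
          (auto intro!: openin_continuous_map_preimage[OF cont] simp del: greaterThanLessThan_iff)
      moreover have "p \<in> topspace T \<inter> \<Inter>(?U ` D)" using pT \<epsilon> by auto
      ultimately obtain z where z: "z \<in> ?P" "z \<in> topspace T \<inter> \<Inter>(?U ` D)"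
        using p unfolding in_closure_of by blast
      have "\<bar>fn c (retr X z) - fn c p\<bar> < \<epsilon>" if "c \<in> D" for c
      proof -
        have "fn c (retr X z) = fn c z" using retr_fn[OF X] z(1) that D(2) by auto
        moreover have "z \<in> ?U c" using z(2) that by blast
        ultimately show ?thesis by (auto simp: abs_less_iff)
      qed
      then show "\<exists>z\<in>C \<inter> cl X. \<forall>c\<in>D. \<bar>fn c z - fn c p\<bar> < \<epsilon>"
        using z(1) retr_in_cl[OF X] by blast
    qed (use closedin_subset[OF C] in auto)
    moreover have "T closure_of (C \<inter> cl X) = C \<inter> cl X"
      using C by (intro closure_of_closedin closedin_Int closedin_closure_of)
    ultimately obtain q where q: "q \<in> C" "q \<in> cl X" "\<forall>c\<in>X. fn c q = fn c p" by auto
    then have "retr X p = q" using retr_unique[OF X pT] by blast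
    then show "p \<in> ?P" using q pT by simp
  qed
  then show "closedin T ?P" using closure_of_subset_eq[of ?P T] by blast
qed (use retr_topspace[OF X] in auto)

lemma not_small_iff: "\<not> small A \<longleftrightarrow> r \<le>o |A|"
  using Card_order card_order_on_well_order_on card_of_Well_order by (intro not_ordLess_iff_ordLeq) blast+

text \<open>Continuity of the chain of stages: an element uses finitely many generators, and these
  have a largest one \<open>n\<close>. The first alternative covers an empty set of
  generators.\<close>

lemma generated_finitary_initial:
  assumes wo: "well_order_on X R" and m: "m \<in> X" and a: "a \<in> generated G (underS R m)"
  shows "a \<in> generated G {} \<or> (\<exists>n\<in>underS R m. a \<in> generated G (under R n))"
proof -
  obtain F where F: "finite F" "F \<subseteq> underS R m" "a \<in> generated G F"
    using generated_finitary[OF a] by blast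
  have FR: "Field R = X" using wo well_order_on_Field by blast
  interpret wo: wo_rel R using wo well_order_on_Well_order by (auto simp: wo_rel_def)
  show ?thesis
  proof (cases "F = {}")
    case False
    have "F \<subseteq> Field R" using F(2) by (auto simp: underS_def Field_def)
    with F(1) False have "\<exists>n\<in>F. \<forall>k\<in>F. (k, n) \<in> R"
    proof (induction F rule: finite_ne_induct)
      case (singleton x)
      then show ?case using wo.REFL by (auto simp: refl_on_def)
    next
      case (insert x F)
      then obtain n where n: "n \<in> F" "\<forall>k\<in>F. (k, n) \<in> R" by auto
      then have "(x, n) \<in> R \<or> (n, x) \<in> R" "(x, x) \<in> R"
        using insert.prems wo.TOTALS wo.REFL by (auto simp: refl_on_def)
      then show ?case
      proof (elim disjE)
        assume "(n, x) \<in> R" "(x, x) \<in> R"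
        then show ?thesis using n wo.TRANS unfolding trans_def by blast
      qed (use n in blast)
    qed
    then obtain n where n: "n \<in> F" "F \<subseteq> under R n" by (auto simp: under_def)
    then show ?thesis using F(2,3) generated_mono[OF n(2)] by blast
  qed (use F(3) in simp)
qed

text \<open>No jump occurs at \<open>m \<notin> N\<close> for a suitable small model \<open>N\<close>: if \<open>n\<close> is the least element of
  \<open>N\<close> above \<open>m\<close>, then the stage before \<open>n\<close> has the same trace on \<open>N\<close> as the stage before \<open>m\<close>, and
  this trace determines the image of the point under the retraction.\<close>

lemma small_jumps:
  assumes X: "rule_closed G X" and wo: "well_order_on X R" and x: "x \<in> topspace T"
  shows "small {m \<in> X. retr (generated G (under R m)) x \<noteq> retr (generated G (underS R m)) x}"
proof -
  have FR: "Field R = X" using wo well_order_on_Field by blast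
  interpret wo: wo_rel R using wo well_order_on_Well_order by (auto simp: wo_rel_def)
  have trans: "(a, c) \<in> R" if "(a, b) \<in> R" "(b, c) \<in> R" for a b c
    using wo.TRANS that by (meson transD)
  have anti: "a = b" if "(a, b) \<in> R" "(b, a) \<in> R" for a b
    using wo.ANTISYM that by (meson antisymD)
  have refl: "(a, a) \<in> R" if "a \<in> X" for a using wo.REFL that FR by (auto simp: refl_on_def)
  define P where "P m = generated G (under R m)" for m
  define P0 where "P0 m = generated G (underS R m)" for m
  have cP: "rule_closed G (P m)" "rule_closed G (P0 m)" for m
    unfolding P_def P0_def by (simp_all add: rule_closed_generated)
  have PX: "P0 m \<subseteq> P m" "P m \<subseteq> X" for m
  proof -
    show "P0 m \<subseteq> P m" unfolding P_def P0_def
      by (rule generated_mono) (auto simp: under_def underS_def)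
    show "P m \<subseteq> X" unfolding P_def using FR
      by (intro generated_least[OF X]) (auto simp: under_def Field_def)
  qed
  have P_P0: "P m \<subseteq> P0 n" if "(m, n) \<in> R" "m \<noteq> n" for m n
    unfolding P_def P0_def using that trans anti
    by (intro generated_mono) (auto simp: under_def underS_def)
  \<comment> \<open>\<open>rk a\<close> is the first stage containing \<open>a\<close>. As
    \<open>N\<close> will be closed under \<open>rk\<close>, its elements from \<open>X\<close>
    enter only at stages that belong to \<open>N\<close>.\<close>
  define rk where "rk a = wo.minim {m \<in> X. a \<in> P m}" for a
  have rk: "rk a \<in> X" "a \<in> P (rk a)" "\<And>m. m \<in> X \<Longrightarrow> a \<in> P m \<Longrightarrow> (rk a, m) \<in> R" if "a \<in> X" for a
  proof -
    have "a \<in> P a" unfolding P_def using refl[OF that] by (auto intro: generated.base simp: under_def)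
    then have ne: "{m \<in> X. a \<in> P m} \<noteq> {}" using that by auto
    have "{m \<in> X. a \<in> P m} \<subseteq> Field R" using FR by auto
    note mi = wo.minim_in[OF this ne] wo.minim_least[OF this]
    show "rk a \<in> X" "a \<in> P (rk a)" "\<And>m. m \<in> X \<Longrightarrow> a \<in> P m \<Longrightarrow> (rk a, m) \<in> R"
      using mi unfolding rk_def by auto
  qed
  \<comment> \<open>The head of the list is read as a stage \<open>n\<close> and the tail as codes.
    Closure under \<open>G'\<close> puts the image of \<open>x\<close> just before stage
    \<open>n\<close>, and its approximations, into \<open>N\<close>.\<close>
  define G' where "G' xs = G xs \<union> (insert (retr X x) (range (approx X (retr X x) xs)) \<union>
      (case xs of [] \<Rightarrow> {} | n # cs \<Rightarrow>
        {rk n, retr (P0 n) x} \<union> range (approx (P0 n) (retr (P0 n) x) cs)))" for xs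
  define N where "N = generated G' {}"
  have N': "rule_closed G' N" unfolding N_def by (rule rule_closed_generated)
  then have N: "rule_closed G N" unfolding G'_def by (rule rule_closed_Un_left)
  have "countable (case xs of [] \<Rightarrow> {} | n # cs \<Rightarrow>
        {rk n, retr (P0 n) x} \<union> range (approx (P0 n) (retr (P0 n) x) cs))" for xs
    by (cases xs) auto
  then have "small (G' xs)" for xs
    unfolding G'_def by (intro small_Un small_G small_countable) auto
  then have sN: "small N" unfolding N_def by (rule small_generated) (simp add: small_countable)
  have N0: "retr X x \<in> N" "approx X (retr X x) cs k \<in> N" if "set cs \<subseteq> N" for cs k
    using N' that unfolding rule_closed_def G'_def by blast+
  have N1: "rk n \<in> N" "retr (P0 n) x \<in> N" "approx (P0 n) (retr (P0 n) x) cs k \<in> N"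
    if "set cs \<subseteq> N" "n \<in> N" for cs n k
  proof -
    have "G' (n # cs) \<subseteq> N" using N' that unfolding rule_closed_def by auto
    then show "rk n \<in> N" "retr (P0 n) x \<in> N" "approx (P0 n) (retr (P0 n) x) cs k \<in> N"
      by (auto simp: G'_def)
  qed
  have "retr (P m) x = retr (P0 m) x" if m: "m \<in> X" "m \<notin> N" for m
  proof -
    have below: "a \<in> P0 m" if a: "a \<in> X" "\<not> (m, rk a) \<in> R" for a
    proof -
      have "(rk a, m) \<in> R" "rk a \<noteq> m"
        using wo.TOTALS FR m(1) rk(1)[OF a(1)] a(2) by auto
      then show ?thesis using P_P0 rk(2)[OF a(1)] by blast
    qed
    have "\<exists>V. rule_closed G V \<and> P m \<subseteq> V \<and> retr V x \<in> cl (V \<inter> N) \<and> V \<inter> N \<subseteq> P0 m"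
    proof (cases "\<exists>n\<in>N \<inter> X. (m, n) \<in> R")
      \<comment> \<open>When no element of \<open>N\<close> in \<open>X\<close> lies above
        \<open>m\<close>, the whole of \<open>X\<close> takes the place of the stage before
        \<open>n\<close>.\<close>
      case False
      have "retr X x \<in> cl (X \<inter> N)"
        using N0 by (intro in_cl_trace_approx[OF N sN N0(1)[of "[]"] retr_in_cl[OF X x]]) auto
      moreover have "X \<inter> N \<subseteq> P0 m"
        using below False N1(1)[of "[]"] rk(1) by auto
      ultimately show ?thesis using X PX by blast
    next
      case True
      define n where "n = wo.minim {n \<in> N \<inter> X. (m, n) \<in> R}"
      have "{n \<in> N \<inter> X. (m, n) \<in> R} \<subseteq> Field R" "{n \<in> N \<inter> X. (m, n) \<in> R} \<noteq> {}"
        using FR True by auto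
      note mi = wo.minim_in[OF this, folded n_def] wo.minim_least[OF this(1), folded n_def]
      have n: "n \<in> N" "n \<in> X" "(m, n) \<in> R" "n \<noteq> m" using mi(1) m(2) by auto
      have "retr (P0 n) x \<in> cl (P0 n \<inter> N)"
        using N1[OF _ n(1)] by (intro in_cl_trace_approx[OF N sN N1(2)[of "[]"] retr_in_cl[OF cP(2) x]])
          (use n in auto)
      moreover have "P0 n \<inter> N \<subseteq> P0 m"
      proof
        fix a assume a: "a \<in> P0 n \<inter> N"
        then consider "a \<in> generated G {}" | k where "k \<in> underS R n" "a \<in> P k"
          using generated_finitary_initial[OF wo n(2), of a] unfolding P_def P0_def by blast
        then show "a \<in> P0 m"
        proof cases
          case 1
          then show ?thesis unfolding P0_def
            using generated_mono[of "{}" "underS R m" G] by (simp add: subset_iff)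
        next
          case 2
          have kX: "k \<in> X" using 2(1) FR by (auto simp: underS_def Field_def)
          have aX: "a \<in> X" using 2 PX by blast
          have "(rk a, k) \<in> R" by (rule rk(3)[OF aX kX 2(2)])
          then have "\<not> (n, rk a) \<in> R"
            using 2(1) trans anti unfolding underS_def by blast
          moreover have "rk a \<in> N \<inter> X" using N1(1)[of "[]"] a rk(1)[OF aX] by auto
          ultimately have "\<not> (m, rk a) \<in> R" using mi(2) by auto
          then show ?thesis by (rule below[OF aX])
        qed
      qed
      ultimately show ?thesis using cP(2) P_P0[of m n] n by blast
    qed
    then obtain V where V: "rule_closed G V" "P m \<subseteq> V" "retr V x \<in> cl (V \<inter> N)" "V \<inter> N \<subseteq> P0 m"
      by blast
    \<comment> \<open>The image under the larger model \<open>V\<close> already lies in the closures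
      of \<open>P0 m\<close> and \<open>P m\<close>, so both retractions send \<open>x\<close> to
      it.\<close>
    then have "retr V x \<in> cl (P0 m)" "retr V x \<in> cl (P m)"
      using cl_mono[of "V \<inter> N" "P0 m"] cl_mono[of "V \<inter> N" "P m"] PX(1)[of m] by auto
    moreover have "P0 m \<subseteq> V" using PX(1) V(2) by blast
    ultimately show ?thesis
      using retr_between[OF cP(1) V(1,2) x] retr_between[OF cP(2) V(1) _ x] by metis
  qed
  then have "{m \<in> X. retr (P m) x \<noteq> retr (P0 m) x} \<subseteq> N" by blast
  then show ?thesis using small_subset[OF _ sN] unfolding P_def P0_def by blast
qed

definition separating_family :: "'a set \<Rightarrow> ('a \<Rightarrow> real) set \<Rightarrow> bool" where
  "separating_family X \<F> \<longleftrightarrow> (\<forall>f\<in>\<F>. continuous_map T euclideanreal f) \<and>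
     (\<forall>x\<in>cl X. \<forall>y\<in>cl X. (\<forall>f\<in>\<F>. f x = f y) \<longrightarrow> x = y) \<and>
     (\<forall>x\<in>topspace T. small {f \<in> \<F>. f x \<noteq> 0})"

text \<open>A small \<open>X\<close> is served by all functions it codes. Otherwise differences lose
  no information: if two points have the same image before stage \<open>m\<close>, the subtracted
  terms agree, so equal differences mean equal values of the family of stage \<open>m\<close>, which
  separates the images at \<open>m\<close>.\<close>

theorem separating_family_exists:
  assumes "rule_closed G X" shows "\<exists>\<F>. separating_family X \<F>"
  using assms
proof (induction "|X|" arbitrary: X rule: wf_induct_rule[OF wf_ordLess])
  case (1 X)
  show ?case
  proof (cases "small X")
    case True
    have "separating_family X (fn ` X)" unfolding separating_family_def
    proof (intro conjI ballI impI)
      show "continuous_map T euclideanreal f" if "f \<in> fn ` X" for f using that cont by auto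
      show "x = y" if "x \<in> cl X" "y \<in> cl X" "\<forall>f\<in>fn ` X. f x = f y" for x y
        using that by (intro separation_any_size[OF 1(2)]) auto
      show "small {f \<in> fn ` X. f x \<noteq> 0}" for x
        by (rule small_subset[OF _ small_image[OF True]]) auto
    qed
    then show ?thesis by blast
  next
    case False
    have rX: "r \<le>o |X|"
      using False by (simp add: not_small_iff)
    have inf: "infinite X"
      using ordLess_ordLeq_trans[OF nat_less rX] by (simp add: infinite_iff_card_of_nat ordLess_imp_ordLeq)
    let ?R = "|X|"
    have wo: "well_order_on X ?R" by (rule card_of_well_order_on)
    have FR: "Field ?R = X" by (rule Field_card_of)
    interpret wo: wo_rel ?R by (simp add: wo_rel_def card_of_Well_order)
    define P where "P m = generated G (under ?R m)" for m
    define P0 where "P0 m = generated G (underS ?R m)" for m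
    have cP: "rule_closed G (P m)" "rule_closed G (P0 m)" for m
      unfolding P_def P0_def by (simp_all add: rule_closed_generated)
    \<comment> \<open>\<open>E\<close> starts the induction along the stages: at the least
      \<open>m\<close> the model \<open>P0 m\<close> is \<open>E\<close>, which is not covered by
      earlier stages.\<close>
    define E where "E = generated G {}"
    have E: "rule_closed G E" "small E"
      unfolding E_def by (simp_all add: rule_closed_generated small_generated small_G small_countable)
    have mP: "m \<in> P m" if "m \<in> X" for m
      unfolding P_def using that wo.REFL FR by (auto intro!: generated.base simp: under_def refl_on_def)
    \<comment> \<open>\<open>?R\<close> has minimal order type, so its proper initial segments are
      smaller than \<open>X\<close>. Closing under the rules keeps a small set small and preserves
      the size bound of any other.\<close>
    have "|P m| <o |X|" if m: "m \<in> X" for m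
    proof -
      have "|underS ?R m| <o ?R" using m by (intro card_of_underS card_of_Card_order) (simp add: FR)
      then have "|insert m (underS ?R m)| <o |X|"
        using card_of_Un_ordLess_infinite[OF inf ordLess_ordLeq_trans[OF small_countable rX], of "{m}"]
        by simp
      moreover have "|under ?R m| \<le>o |insert m (underS ?R m)|"
        by (rule card_of_mono1) (auto simp: under_def underS_def)
      ultimately have u: "|under ?R m| <o |X|" by (rule ordLeq_ordLess_trans[rotated])
      show ?thesis
      proof (cases "small (under ?R m)")
        case True
        then show ?thesis unfolding P_def
          by (intro ordLess_ordLeq_trans[OF _ rX] small_generated small_G)
      next
        case False
        then have "r \<le>o |under ?R m|"
          by (simp add: not_small_iff)
        then have "|P m| \<le>o |under ?R m|" unfolding P_def by (intro large_generated small_G)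
        then show ?thesis using u by (rule ordLeq_ordLess_trans)
      qed
    qed
    then have "\<forall>m\<in>X. \<exists>\<F>. separating_family (P m) \<F>" using 1(1) cP(1) by blast
    then obtain \<F> where \<F>: "\<And>m. m \<in> X \<Longrightarrow> separating_family (P m) (\<F> m)" by metis
    obtain \<E> where \<E>: "separating_family E \<E>"
      using 1(1)[OF ordLess_ordLeq_trans[OF E(2) rX] E(1)] by blast
    define h where "h = (\<lambda>(m, s) x. s (retr (P m) x) - s (retr (P0 m) x) :: real)"
    let ?H = "(\<lambda>s x. s (retr E x)) ` \<E> \<union> h ` (SIGMA m:X. \<F> m)"
    have cr: "continuous_map T euclideanreal (\<lambda>x. s (retr Y x))"
      if "continuous_map T euclideanreal s" "rule_closed G Y" for s Y
      using continuous_map_compose[OF continuous_map_retr[OF that(2)] that(1)] by (simp add: o_def)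
    have "separating_family X ?H" unfolding separating_family_def
    proof (intro conjI ballI impI)
      fix f assume "f \<in> ?H"
      then show "continuous_map T euclideanreal f"
      proof
        assume "f \<in> (\<lambda>s x. s (retr E x)) ` \<E>"
        then show ?thesis using cr E(1) \<E> by (auto simp: separating_family_def)
      next
        assume "f \<in> h ` (SIGMA m:X. \<F> m)"
        then obtain m s where "m \<in> X" "s \<in> \<F> m" and f: "f = h (m, s)" by auto
        then have "continuous_map T euclideanreal s" using \<F> by (auto simp: separating_family_def)
        then show ?thesis unfolding f h_def
          using cr cP by (auto intro!: continuous_map_diff)
      qed
    next
      fix x y assume x: "x \<in> cl X" and y: "y \<in> cl X" and eq: "\<forall>f\<in>?H. f x = f y"
      note T = cl_topspace[OF x] cl_topspace[OF y]
      have eqE: "s (retr E x) = s (retr E y)" if "s \<in> \<E>" for s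
        using bspec[OF eq, of "\<lambda>x. s (retr E x)"] that by blast
      have eqh: "h (m, s) x = h (m, s) y" if "m \<in> X" "s \<in> \<F> m" for m s
        using eq that by blast
      have "retr E x = retr E y"
        using \<E> eqE retr_in_cl[OF E(1) T(1)] retr_in_cl[OF E(1) T(2)]
        by (auto simp: separating_family_def)
      then have fnE: "fn c x = fn c y" if "c \<in> E" for c
        using that retr_eq_iff[OF E(1) T] by blast
      have "m \<in> X \<longrightarrow> retr (P m) x = retr (P m) y" for m
      proof (induction m rule: wo.well_order_induct)
        case (1 m)
        show ?case
        proof
          assume m: "m \<in> X"
          have "fn c x = fn c y" if c: "c \<in> P0 m" for c
          proof -
            consider "c \<in> E" | n where "n \<in> underS ?R m" "c \<in> P n"
              using generated_finitary_initial[OF wo m, of c] c unfolding P_def P0_def E_def by blast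
            then show ?thesis
            proof cases
              case 2
              then have "n \<noteq> m" "(n, m) \<in> ?R" "n \<in> X"
                using FR by (auto simp: underS_def Field_def)
              then have "retr (P n) x = retr (P n) y" using 1 by blast
              then show ?thesis using 2 retr_eq_iff[OF cP(1) T] by blast
            qed (rule fnE)
          qed
          then have "retr (P0 m) x = retr (P0 m) y" using retr_eq_iff[OF cP(2) T] by blast
          then have "\<forall>s\<in>\<F> m. s (retr (P m) x) = s (retr (P m) y)"
            using eqh[OF m] by (auto simp: h_def)
          then show "retr (P m) x = retr (P m) y"
            using \<F>[OF m] retr_in_cl[OF cP(1) T(1)] retr_in_cl[OF cP(1) T(2)]
            unfolding separating_family_def by blast
        qed
      qed
      then have "fn c x = fn c y" if "c \<in> X" for c
        using retr_eq_iff[OF cP(1) T] mP[OF that] that by blast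
      then show "x = y" by (rule separation_any_size[OF 1(2) x y])
    next
      fix x assume x: "x \<in> topspace T"
      \<comment> \<open>A difference is nonzero at \<open>x\<close> only if \<open>x\<close> jumps
        at \<open>m\<close> and \<open>s\<close> is nonzero at one of the two images.\<close>
      let ?J = "{m \<in> X. retr (P m) x \<noteq> retr (P0 m) x}"
      let ?S = "\<lambda>m. {s \<in> \<F> m. s (retr (P m) x) \<noteq> 0} \<union> {s \<in> \<F> m. s (retr (P0 m) x) \<noteq> 0}"
      have J: "small ?J"
        using small_jumps[OF 1(2) wo x] unfolding P_def P0_def .
      have "small (?S m)" if "m \<in> ?J" for m
        using \<F>[of m] that retr_topspace[OF cP(1) x] retr_topspace[OF cP(2) x]
        by (intro small_Un) (auto simp: separating_family_def)
      then have "small (\<Union>m\<in>?J. (\<lambda>s. h (m, s)) ` ?S m)"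
        by (intro small_UN[OF J] small_image)
      moreover have "small ((\<lambda>s x. s (retr E x)) ` {s \<in> \<E>. s (retr E x) \<noteq> 0})"
        using \<E> retr_topspace[OF E(1) x] by (intro small_image) (auto simp: separating_family_def)
      ultimately have "small ((\<lambda>s x. s (retr E x)) ` {s \<in> \<E>. s (retr E x) \<noteq> 0} \<union>
          (\<Union>m\<in>?J. (\<lambda>s. h (m, s)) ` ?S m))"
        by (rule small_Un[rotated])
      moreover have "{f \<in> ?H. f x \<noteq> 0} \<subseteq> (\<lambda>s x. s (retr E x)) ` {s \<in> \<E>. s (retr E x) \<noteq> 0} \<union>
          (\<Union>m\<in>?J. (\<lambda>s. h (m, s)) ` ?S m)"
      proof
        fix f assume f: "f \<in> {f \<in> ?H. f x \<noteq> 0}"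
        then consider s where "s \<in> \<E>" "f = (\<lambda>x. s (retr E x))"
          | m s where "m \<in> X" "s \<in> \<F> m" "f = h (m, s)" by auto
        then show "f \<in> (\<lambda>s x. s (retr E x)) ` {s \<in> \<E>. s (retr E x) \<noteq> 0} \<union>
          (\<Union>m\<in>?J. (\<lambda>s. h (m, s)) ` ?S m)"
        proof cases
          case 1
          then show ?thesis using f by auto
        next
          case 2
          then have ne: "s (retr (P m) x) \<noteq> s (retr (P0 m) x)" using f by (auto simp: h_def)
          then have "m \<in> ?J" using 2(1) by auto
          moreover have "s \<in> ?S m" using ne 2(2) by auto
          ultimately show ?thesis using 2(3) by blast
        qed
      qed
      ultimately show "small {f \<in> ?H. f x \<noteq> 0}" by (rule small_subset[rotated])
    qed
    then show ?thesis by blast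
  qed
qed

end

section \<open>Cardinals, hereditarily small sets and Skolem closure in the universe\<close>

section \<open>Sets and cardinals in the universe\<close>

lemma lesspoll_iff_ordLess: "A \<prec> B \<longleftrightarrow> |A| <o |B|"
  unfolding lesspoll_def lepoll_def eqpoll_def card_of_ordLeq card_of_ordIso
  using not_ordLess_ordIso ordLeq_iff_ordLess_or_ordIso by blast

lemma lepoll_iff_ordLeq: "A \<lesssim> B \<longleftrightarrow> |A| \<le>o |B|"
  unfolding lepoll_def card_of_ordLeq ..

lemma is_set_subset: "Y \<subseteq> X \<Longrightarrow> X \<in> range elts \<Longrightarrow> Y \<in> range elts"
  using separation by blast

lemma is_set_elts [simp]: "elts x \<in> range elts"
  by blast

lemma is_set_lepoll:
  fixes A B :: "'v::zfc_universe set"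
  assumes "A \<lesssim> B" "B \<in> range elts" shows "A \<in> range elts"
proof -
  obtain g where "A \<subseteq> g ` B" using assms(1) unfolding lepoll_iff by blast
  then show ?thesis by (rule is_set_subset[OF _ replacement[OF assms(2)]])
qed

lemma is_set_UN:
  fixes A :: "'v \<Rightarrow> 'v::zfc_universe set"
  assumes "I \<in> range elts" "\<And>i. i \<in> I \<Longrightarrow> A i \<in> range elts"
  shows "(\<Union>i\<in>I. A i) \<in> range elts"
proof -
  have "(\<Union>i\<in>I. A i) = \<Union> (elts ` ((\<lambda>i. vset (A i)) ` I))"
    using assms(2) by (simp add: elts_vset)
  also have "\<dots> \<in> range elts" by (rule union_ax[OF replacement[OF assms(1)]])
  finally show ?thesis .
qed

lemma is_set_Un: "A \<in> range elts \<Longrightarrow> B \<in> range elts \<Longrightarrow> A \<union> B \<in> range elts"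
  using is_set_UN[of "{vset A, vset B}" elts] by (simp add: countable_is_set elts_vset)

lemma mem_irrefl: "x \<notin> elts (x :: 'v::zfc_universe)"
  using wf_irrefl[OF foundation] by auto

lemma mem_induct [case_names mem]:
  fixes x :: "'v::zfc_universe"
  assumes "\<And>x. (\<And>y. y \<in> elts x \<Longrightarrow> P y) \<Longrightarrow> P x" shows "P x"
  using foundation by (rule wf_induct_rule) (use assms in auto)

lemma ordinal_mem: "ordinal \<alpha> \<Longrightarrow> \<beta> \<in> elts \<alpha> \<Longrightarrow> ordinal \<beta>"
  unfolding ordinal_def transitive_set_def by blast

lemma ordinal_subset: "ordinal \<alpha> \<Longrightarrow> \<beta> \<in> elts \<alpha> \<Longrightarrow> elts \<beta> \<subseteq> elts \<alpha>"
  unfolding ordinal_def transitive_set_def by blast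

lemma ordinal_linear:
  "ordinal \<alpha> \<Longrightarrow> ordinal \<beta> \<Longrightarrow> \<alpha> \<in> elts \<beta> \<or> \<alpha> = \<beta> \<or> \<beta> \<in> elts (\<alpha> :: 'v::zfc_universe)"
proof (induction \<alpha> arbitrary: \<beta> rule: mem_induct)
  case (mem \<alpha>)
  note IH\<alpha> = mem.IH and \<alpha> = mem.prems(1)
  from mem.prems(2) show ?case
  proof (induction \<beta> rule: mem_induct)
    case (mem \<beta>)
    have "elts \<alpha> = elts \<beta>" if "\<alpha> \<notin> elts \<beta>" "\<beta> \<notin> elts \<alpha>"
    proof (intro equalityI subsetI)
      fix \<gamma> assume "\<gamma> \<in> elts \<alpha>"
      then show "\<gamma> \<in> elts \<beta>"
        using IH\<alpha>[of \<gamma> \<beta>] ordinal_mem[OF \<alpha>] ordinal_subset[OF \<alpha>] mem.prems that by blast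
    next
      fix \<gamma> assume "\<gamma> \<in> elts \<beta>"
      then show "\<gamma> \<in> elts \<alpha>"
        using mem.IH[of \<gamma>] ordinal_mem[OF mem.prems] ordinal_subset[OF mem.prems] that by blast
    qed
    then show ?case using extensionality by blast
  qed
qed

text \<open>The collapse of a well-order of minimal type on \<open>D\<close>.\<close>

lemma cardinal_exists:
  fixes D :: "'v::zfc_universe set"
  assumes D: "D \<in> range elts"
  shows "\<exists>\<theta>::'v. cardinal \<theta> \<and> elts \<theta> \<approx> D \<and> (infinite D \<and> stable |D| \<longrightarrow> regular_cardinal \<theta>)"
proof -
  let ?R = "|D|"
  have FR: "Field ?R = D" by (rule Field_card_of)
  interpret wo: wo_rel ?R by (simp add: wo_rel_def card_of_Well_order)
  have trans: "(a, c) \<in> ?R" if "(a, b) \<in> ?R" "(b, c) \<in> ?R" for a b c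
    using wo.TRANS that by (meson transD)
  have anti: "a = b" if "(a, b) \<in> ?R" "(b, a) \<in> ?R" for a b
    using wo.ANTISYM that by (meson antisymD)
  have tot: "(a, b) \<in> ?R \<or> (b, a) \<in> ?R" if "a \<in> D" "b \<in> D" for a b
    using wo.TOTALS that FR by auto
  have inD: "a \<in> D" "b \<in> D" if "(a, b) \<in> ?R" for a b
    using that FR by (auto simp: Field_def)
  define p :: "'v \<Rightarrow> 'v" where "p = wfrec (?R - Id) (\<lambda>p d. vset (p ` underS ?R d))"
  have p: "p d = vset (p ` underS ?R d)" for d
    unfolding p_def using wo.WF
    by (subst wfrec) (auto intro!: arg_cong[where f = vset] image_cong simp: cut_def underS_def)
  have us: "underS ?R d \<subseteq> D" for d using FR by (auto simp: underS_def Field_def)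
  have ep: "elts (p d) = p ` underS ?R d" for d
    using p[of d] elts_vset[OF replacement[OF is_set_subset[OF us D]]] by metis
  define \<theta> :: 'v where "\<theta> = vset (p ` D)"
  have e\<theta>: "elts \<theta> = p ` D" unfolding \<theta>_def by (rule elts_vset[OF replacement[OF D]])
  have tr: "transitive_set (p d)" for d
    unfolding transitive_set_def ep using trans anti by (fastforce simp: ep underS_def)
  have ord: "ordinal \<theta>"
    unfolding ordinal_def transitive_set_def[of \<theta>] e\<theta> using tr us by (auto simp: ep)
  have less: "p a \<in> elts (p b)" if "(a, b) \<in> ?R" "a \<noteq> b" for a b
    using that by (auto simp: ep underS_def)
  have inj: "inj_on p D"
  proof (rule inj_onI, rule ccontr)
    fix a b assume "a \<in> D" "b \<in> D" "p a = p b" "a \<noteq> b"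
    then show False using tot less mem_irrefl by metis
  qed
  have eq: "elts \<theta> \<approx> D" unfolding e\<theta> using inj_on_image_eqpoll_self[OF inj] .
  have card: "cardinal \<theta>" unfolding cardinal_def
  proof (intro conjI ballI)
    fix \<alpha> assume "\<alpha> \<in> elts \<theta>"
    then obtain d where d: "d \<in> D" "\<alpha> = p d" unfolding e\<theta> by blast
    have "|underS ?R d| <o |D|" using d by (intro card_of_underS card_of_Card_order) (simp add: FR)
    then have "underS ?R d \<prec> D" by (simp add: lesspoll_iff_ordLess)
    then show "elts \<alpha> \<prec> elts \<theta>"
      unfolding d(2) ep by (meson eq eqpoll_sym image_lepoll lesspoll_eq_trans lesspoll_trans1)
  qed (rule ord)
  have "regular_cardinal \<theta>" if st: "infinite D" "stable |D|"
    unfolding regular_cardinal_def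
  proof (intro conjI allI impI)
    show "infinite (elts \<theta>)" using eq st(1) by (simp add: eqpoll_finite_iff)
    fix X assume X: "X \<subseteq> elts \<theta>" "X \<prec> elts \<theta>"
    then obtain Y where Y: "Y \<subseteq> D" "X = p ` Y" unfolding e\<theta> by (meson subset_imageE)
    have "Y \<approx> X" unfolding Y(2) using inj_on_subset[OF inj Y(1)] by (simp add: inj_on_image_eqpoll_self eqpoll_sym)
    then have "|Y| <o |D|"
      using X(2) eq unfolding lesspoll_iff_ordLess[symmetric] by (meson eq_lesspoll_trans lesspoll_eq_trans)
    moreover have "|insert d (underS ?R d)| <o |D|" if "d \<in> Y" for d
    proof -
      have "|underS ?R d| <o |D|"
        using that Y(1) by (intro card_of_underS card_of_Card_order) (auto simp: FR)
      moreover have "{d} \<prec> D" using st(1) by (simp add: finite_lesspoll_infinite)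
      ultimately show ?thesis
        using card_of_Un_ordLess_infinite[OF st(1), of "{d}" "underS ?R d"] by (simp add: lesspoll_iff_ordLess)
    qed
    \<comment> \<open>Stability keeps this union of initial segments smaller than \<open>D\<close>,
      so some \<open>b\<close> lies beyond all of them and its collapse bounds
      \<open>X\<close>.\<close>
    ultimately have "|\<Union>d\<in>Y. insert d (underS ?R d)| <o |D|"
      using st(2) by (intro stable_UNION)
    then have "(\<Union>d\<in>Y. insert d (underS ?R d)) \<noteq> D"
      using ordLess_irreflexive by metis
    moreover have "(\<Union>d\<in>Y. insert d (underS ?R d)) \<subseteq> D" using us Y(1) by blast
    ultimately obtain b where b: "b \<in> D" "b \<notin> (\<Union>d\<in>Y. insert d (underS ?R d))" by blast
    have "p d \<in> elts (p b)" if "d \<in> Y" for d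
    proof -
      have "d \<noteq> b" "(b, d) \<notin> ?R" using b(2) that by (auto simp: underS_def)
      then show ?thesis using tot[of b d] b(1) that Y(1) less by blast
    qed
    then show "\<exists>\<beta>\<in>elts \<theta>. X \<subseteq> elts \<beta>"
      unfolding e\<theta> Y(2) using b(1) by blast
  qed (rule card)
  with card eq show ?thesis by (intro exI[of _ \<theta>]) simp
qed

text \<open>The successor of \<open>|D|\<close> is regular, but HOL builds it on another type. It
  embeds into the power set of \<open>D\<close>, where its image \<open>E\<close> is a set of the
  universe and can be collapsed to an ordinal.\<close>

lemma regular_cardinal_above:
  fixes D :: "'v::zfc_universe set"
  assumes D: "D \<in> range elts" and inf: "infinite D"
  shows "\<exists>\<theta>::'v. regular_cardinal \<theta> \<and> D \<prec> elts \<theta>"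
proof -
  let ?s = "cardSuc |D|"
  have less: "|D| <o ?s" by (rule cardSuc_greater[OF card_of_Card_order])
  have s: "|Field ?s| =o ?s" by (rule card_of_Field_ordIso[OF cardSuc_Card_order[OF card_of_Card_order]])
  let ?P = "{y. elts y \<subseteq> D}"
  have ev: "elts (vset X :: 'v) = X" if "X \<in> Pow D" for X
    using elts_vset[OF is_set_subset[OF _ D]] that by (simp only: Pow_iff)
  then have "inj_on (vset :: _ \<Rightarrow> 'v) (Pow D)" by (rule inj_on_inverseI)
  moreover have "vset ` Pow D \<subseteq> ?P" using ev by (simp add: image_subset_iff)
  ultimately have "|Pow D| \<le>o |?P|" using card_of_ordLeq by blast
  then have "|D| <o |?P|" using card_of_Pow ordLess_ordLeq_trans by blast
  then have "?s \<le>o |?P|" by (rule cardSuc_least[OF card_of_Card_order card_of_Card_order])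
  then have "|Field ?s| \<le>o |?P|" using s ordIso_ordLeq_trans by blast
  then obtain f where f: "inj_on f (Field ?s)" "f ` Field ?s \<subseteq> ?P" using card_of_ordLeq by metis
  define E where "E = f ` Field ?s"
  have "bij_betw f (Field ?s) E" using f(1) by (simp add: E_def bij_betw_def)
  then have "|Field ?s| =o |E|" using card_of_ordIso by blast
  then have Es: "|E| =o ?s" using s ordIso_symmetric ordIso_transitive by blast
  have "E \<in> range elts" using f(2) power_ax[OF D] unfolding E_def by (rule is_set_subset)
  moreover have "infinite E" unfolding E_def
    using inf f(1) by (simp add: finite_image_iff card_of_cardSuc_finite)
  moreover have "stable |E|"
  proof (rule stable_ordIso1[OF _ Es], rule regularCard_stable)
    show "Card_order ?s" by (rule cardSuc_Card_order[OF card_of_Card_order])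
    show "infinite (Field ?s)" using inf by (simp add: card_of_cardSuc_finite)
    show "regularCard ?s"
      by (rule infinite_cardSuc_regularCard[OF _ card_of_Card_order]) (simp add: inf Field_card_of)
  qed
  ultimately obtain \<theta> :: 'v where reg: "regular_cardinal \<theta>" and \<theta>: "elts \<theta> \<approx> E"
    using cardinal_exists[of E] by blast
  have "D \<prec> E"
    unfolding lesspoll_iff_ordLess using less Es ordIso_symmetric ordLess_ordIso_trans by blast
  then have "D \<prec> elts \<theta>" by (rule lesspoll_eq_trans[OF _ eqpoll_sym[OF \<theta>]])
  with reg show ?thesis by blast
qed

lemma cardinal_subset:
  assumes "cardinal \<mu>" "cardinal \<theta>" "elts \<mu> \<prec> elts \<theta>"
  shows "elts \<mu> \<subseteq> elts \<theta>"
proof -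
  have o: "ordinal \<mu>" "ordinal \<theta>" using assms by (auto simp: cardinal_def)
  have "\<theta> \<notin> elts \<mu>"
    using assms(3) ordinal_subset[OF o(1)] by (meson lesspoll_not_refl lesspoll_trans1 subset_imp_lepoll lesspoll_trans2)
  then show ?thesis using ordinal_linear[OF o] ordinal_subset[OF o(2)] by blast
qed

lemma lesspoll_Times:
  assumes C: "infinite C" "A \<prec> C" "B \<prec> C" shows "A \<times> B \<prec> C"
proof (cases "finite (A <+> B)")
  case True
  then show ?thesis using C(1) by (simp add: finite_lesspoll_infinite)
next
  case False
  have "|A <+> B| <o |C|"
    using C by (intro card_of_Plus_ordLess_infinite) (simp_all add: lesspoll_iff_ordLess)
  moreover have "|A \<times> B| \<le>o |A <+> B|"
    using False by (intro card_of_Times_ordLeq_infinite_Field card_of_Plus1 card_of_Plus2 card_of_Card_order)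
      (simp add: Field_card_of)
  ultimately show ?thesis unfolding lesspoll_iff_ordLess by (rule ordLeq_ordLess_trans[rotated])
qed

text \<open>Regularity bounds a copy of \<open>A\<close> inside \<kappa>. Smallness thereby becomes
  an injection into an element of \<kappa>, a form that a formula can express.\<close>

lemma lesspoll_regular_bounded:
  assumes \<kappa>: "regular_cardinal \<kappa>" and A: "A \<prec> elts \<kappa>"
  shows "\<exists>\<beta>\<in>elts \<kappa>. A \<lesssim> elts \<beta>"
proof -
  obtain g where g: "inj_on g A" "g ` A \<subseteq> elts \<kappa>"
    using lesspoll_imp_lepoll[OF A] by (auto simp: lepoll_def)
  then have e: "g ` A \<approx> A" by (simp add: inj_on_image_eqpoll_self)
  then have "g ` A \<prec> elts \<kappa>" using A eq_lesspoll_trans by blast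
  then obtain \<beta> where "\<beta> \<in> elts \<kappa>" "g ` A \<subseteq> elts \<beta>"
    using \<kappa> g(2) unfolding regular_cardinal_def by blast
  then show ?thesis using lepoll_trans1[OF eqpoll_sym[OF e] subset_imp_lepoll] by blast
qed

text \<open>Each \<open>F a\<close> embeds into some \<open>b a\<close> below \<kappa>, and
  regularity bounds these by one \<gamma>. The disjoint union then embeds into
  \<open>A \<times> elts \<gamma>\<close>, a product of two smaller sets.\<close>

lemma stable_regular_cardinal:
  assumes \<kappa>: "regular_cardinal (\<kappa> :: 'v::zfc_universe)"
  shows "stable |elts \<kappa>|"
  unfolding stable_def
proof (intro allI impI, elim conjE)
  fix A :: "'v set" and F :: "'v \<Rightarrow> 'v set"
  assume "|A| <o |elts \<kappa>|" and "\<forall>a\<in>A. |F a| <o |elts \<kappa>|"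
  then have A: "A \<prec> elts \<kappa>" and F: "\<And>a. a \<in> A \<Longrightarrow> F a \<prec> elts \<kappa>"
    by (auto simp: lesspoll_iff_ordLess)
  have "\<exists>\<beta>\<in>elts \<kappa>. F a \<lesssim> elts \<beta>" if "a \<in> A" for a
    using lesspoll_regular_bounded[OF \<kappa> F[OF that]] .
  then obtain b where b: "\<And>a. a \<in> A \<Longrightarrow> b a \<in> elts \<kappa> \<and> F a \<lesssim> elts (b a)" by metis
  have "b ` A \<prec> elts \<kappa>" using lesspoll_trans1[OF image_lepoll A] .
  then obtain \<gamma> where \<gamma>: "\<gamma> \<in> elts \<kappa>" "b ` A \<subseteq> elts \<gamma>" using \<kappa> b unfolding regular_cardinal_def by blast
  have "ordinal \<kappa>" using \<kappa> by (simp add: regular_cardinal_def cardinal_def)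
  then have "elts (b a) \<subseteq> elts \<gamma>" if "a \<in> A" for a
    using ordinal_subset[OF ordinal_mem[OF _ \<gamma>(1)]] \<gamma>(2) that by blast
  then have "\<forall>a\<in>A. |F a| \<le>o |elts \<gamma>|"
    using b unfolding lepoll_iff_ordLeq[symmetric] by (meson lepoll_trans subset_imp_lepoll)
  then have "|SIGMA a:A. F a| \<le>o |A \<times> elts \<gamma>|" by (rule card_of_Sigma_mono1)
  moreover have "|A \<times> elts \<gamma>| <o |elts \<kappa>|"
    using \<kappa> A \<gamma>(1) unfolding lesspoll_iff_ordLess[symmetric]
    by (intro lesspoll_Times) (auto simp: regular_cardinal_def cardinal_def)
  ultimately show "|SIGMA a:A. F a| <o |elts \<kappa>|" by (rule ordLeq_ordLess_trans)
qed

lemma regular_lesspoll_UN: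
  fixes \<kappa> :: "'v::zfc_universe"
  assumes "regular_cardinal \<kappa>" "I \<prec> elts \<kappa>" "\<And>i. i \<in> I \<Longrightarrow> A i \<prec> elts \<kappa>"
  shows "(\<Union>i\<in>I. A i) \<prec> elts \<kappa>"
  using assms(2,3) unfolding lesspoll_iff_ordLess
  by (rule stable_UNION[OF stable_regular_cardinal[OF assms(1)]])

section \<open>Hereditarily small sets\<close>

lemma elts_subset_trans_closure: "elts x \<subseteq> trans_closure x"
  by (auto simp: trans_closure_def)

lemma trans_closure_mem: "y \<in> trans_closure x \<Longrightarrow> elts y \<subseteq> trans_closure x"
  by (auto simp: trans_closure_def intro: trancl_into_trancl2)

lemma trans_closure_least:
  assumes "elts x \<subseteq> A" "\<And>y. y \<in> A \<Longrightarrow> elts y \<subseteq> A"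
  shows "trans_closure x \<subseteq> A"
proof
  fix y assume "y \<in> trans_closure x"
  then have "(y, x) \<in> {(u, v). u \<in> elts v}\<^sup>+" by (simp add: trans_closure_def)
  then show "y \<in> A" by (induction rule: converse_trancl_induct) (use assms in auto)
qed

lemma trans_closure_mono: "elts y \<subseteq> trans_closure x \<Longrightarrow> trans_closure y \<subseteq> trans_closure x"
  by (rule trans_closure_least) (auto dest: trans_closure_mem)

lemma trans_closure_eq: "trans_closure x = (\<Union>y\<in>elts x. insert y (trans_closure y))"
proof
  show "trans_closure x \<subseteq> (\<Union>y\<in>elts x. insert y (trans_closure y))"
    by (rule trans_closure_least) (use elts_subset_trans_closure trans_closure_mem in blast)+
  show "(\<Union>y\<in>elts x. insert y (trans_closure y)) \<subseteq> trans_closure x"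
    using elts_subset_trans_closure[of x] trans_closure_mem[of _ x] trans_closure_mono by blast
qed

lemma is_set_trans_closure: "trans_closure (x :: 'v::zfc_universe) \<in> range elts"
proof (induction x rule: mem_induct)
  case (mem x)
  have "insert y (trans_closure y) \<in> range elts" if "y \<in> elts x" for y
    using is_set_Un[of "{y}", OF countable_is_set mem[OF that]] by simp
  then show ?case by (subst trans_closure_eq) (rule is_set_UN, simp_all)
qed

lemma Hset_mem: "x \<in> Hset \<theta> \<Longrightarrow> y \<in> elts x \<Longrightarrow> y \<in> Hset \<theta>"
  unfolding Hset_def using trans_closure_mono[of y x] trans_closure_mem[of y x] elts_subset_trans_closure
  by (auto intro: lesspoll_trans1[OF subset_imp_lepoll])

lemma elts_lesspoll: "x \<in> Hset \<theta> \<Longrightarrow> elts x \<prec> elts \<theta>"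
  unfolding Hset_def using lesspoll_trans1[OF subset_imp_lepoll[OF elts_subset_trans_closure]] by blast

text \<open>Regularity of \<theta> bounds the transitive closure, a union of fewer than \<theta>
  sets of size below \<theta>.\<close>

lemma Hset_I:
  assumes \<theta>: "regular_cardinal \<theta>" and x: "elts x \<subseteq> Hset \<theta>" "elts x \<prec> elts \<theta>"
  shows "x \<in> Hset \<theta>"
proof -
  have "insert y (trans_closure y) \<prec> elts \<theta>" if "y \<in> elts x" for y
  proof (cases "finite (trans_closure y)")
    case True
    then show ?thesis using \<theta> by (simp add: regular_cardinal_def finite_lesspoll_infinite)
  next
    case False
    then have "insert y (trans_closure y) \<approx> trans_closure y" by (rule infinite_insert_eqpoll)
    moreover have "trans_closure y \<prec> elts \<theta>" using x(1) that by (auto simp: Hset_def)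
    ultimately show ?thesis by (rule eq_lesspoll_trans)
  qed
  then have "trans_closure x \<prec> elts \<theta>"
    using x(2) by (subst trans_closure_eq) (rule regular_lesspoll_UN[OF \<theta>])
  then show ?thesis by (simp add: Hset_def)
qed

section \<open>Skolem closure\<close>

instance fm :: countable
  by countable_datatype

primrec var_bound :: "fm \<Rightarrow> nat" where
  "var_bound (Mem i j) = Suc (max i j)"
| "var_bound (Eq i j) = Suc (max i j)"
| "var_bound (Neg \<phi>) = var_bound \<phi>"
| "var_bound (Conj \<phi> \<psi>) = max (var_bound \<phi>) (var_bound \<psi>)"
| "var_bound (Exists i \<phi>) = max (Suc i) (var_bound \<phi>)"

lemma sats_agree:
  "(\<And>n. n < var_bound \<phi> \<Longrightarrow> s n = t n) \<Longrightarrow> sats A \<phi> s = sats A \<phi> t"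
proof (induction \<phi> arbitrary: s t)
  case (Exists i \<phi>)
  have "sats A \<phi> (s(i := a)) = sats A \<phi> (t(i := a))" for a
    by (rule Exists.IH) (use Exists.prems in auto)
  then show ?case by simp
next
  case (Neg \<phi>)
  then show ?case by (metis sats.simps(3) var_bound.simps(3))
next
  case (Conj \<phi> \<psi>)
  have "sats A \<phi> s = sats A \<phi> t" by (rule Conj.IH(1)) (use Conj.prems in auto)
  moreover have "sats A \<psi> s = sats A \<psi> t" by (rule Conj.IH(2)) (use Conj.prems in auto)
  ultimately show ?case by simp
qed auto

definition list_env :: "'a \<Rightarrow> 'a list \<Rightarrow> nat \<Rightarrow> 'a" where
  "list_env d xs n = (if n < length xs then xs ! n else d)"

text \<open>A formula depends on finitely many variables, so a list holds its parameters. There are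
  countably many pairs of a formula and a variable, so the values for one list form a countable
  set.\<close>

definition skolem :: "'v::zfc_universe set \<Rightarrow> 'v \<Rightarrow> 'v list \<Rightarrow> fm \<times> nat \<Rightarrow> 'v" where
  "skolem H d xs p = (let P = \<lambda>a. a \<in> H \<and> sats H (fst p) ((list_env d xs)(snd p := a))
     in if Ex P then Eps P else d)"

lemma skolem_in: "d \<in> H \<Longrightarrow> skolem H d xs p \<in> H"
  unfolding skolem_def Let_def by (auto intro: someI2_ex[where Q = "\<lambda>a. a \<in> H"])

text \<open>The Tarski-Vaught test, by induction on the formula.\<close>

lemma elementary_submodel_if_skolem_closed:
  assumes X: "X \<subseteq> H" "X \<noteq> {}"
    and closed: "\<And>xs p. set xs \<subseteq> X \<Longrightarrow> skolem H d xs p \<in> X"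
  shows "elementary_submodel X H"
proof -
  have "range s \<subseteq> X \<Longrightarrow> sats X \<phi> s = sats H \<phi> s" for \<phi> s
  proof (induction \<phi> arbitrary: s)
    case (Exists i \<phi>)
    have IH: "sats X \<phi> (s(i := a)) = sats H \<phi> (s(i := a))" if "a \<in> X" for a
      by (rule Exists.IH) (use Exists.prems that in auto)
    show ?case
    proof
      assume "sats X (Exists i \<phi>) s"
      then show "sats H (Exists i \<phi>) s" using IH X(1) by auto
    next
      assume "sats H (Exists i \<phi>) s"
      then obtain a where a: "a \<in> H" "sats H \<phi> (s(i := a))" by auto
      define xs where "xs = map s [0..<var_bound \<phi>]"
      let ?P = "\<lambda>a. a \<in> H \<and> sats H \<phi> ((list_env d xs)(i := a))"
      have eq: "sats H \<phi> ((list_env d xs)(i := b)) = sats H \<phi> (s(i := b))" for b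
        by (rule sats_agree) (simp add: list_env_def xs_def)
      have ex: "Ex ?P" using a eq by blast
      then have "skolem H d xs (\<phi>, i) = Eps ?P" by (simp add: skolem_def)
      then have sk: "sats H \<phi> (s(i := skolem H d xs (\<phi>, i)))" using someI_ex[OF ex] eq by simp
      have "skolem H d xs (\<phi>, i) \<in> X"
        by (rule closed) (use Exists.prems in \<open>auto simp: xs_def\<close>)
      then show "sats X (Exists i \<phi>) s" using sk IH by auto
    qed
  qed auto
  then show ?thesis using X by (auto simp: elementary_submodel_def)
qed

section \<open>Graphs of real functions\<close>

lemma vpair_mem_vgraph: "vpair x u \<in> elts (vgraph K f) \<longleftrightarrow> x \<in> elts K \<and> u = vreal (f x)"
  by (auto simp: elts_vgraph vpair_inject)

lemma vgraph_eq_iff: "vgraph K f = vgraph K g \<longleftrightarrow> (\<forall>x\<in>elts K. f x = g x)"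
proof
  assume "vgraph K f = vgraph K g"
  then have "vpair x (vreal (f x)) \<in> elts (vgraph K g)" if "x \<in> elts K" for x
    using that by (metis vpair_mem_vgraph)
  then show "\<forall>x\<in>elts K. f x = g x"
    by (simp add: vpair_mem_vgraph vreal_inject)
next
  assume eq: "\<forall>x\<in>elts K. f x = g x"
  have "{vpair x (vreal (f x)) | x. x \<in> elts K} = {vpair x (vreal (g x)) | x. x \<in> elts K}"
    using eq by (metis (no_types, lifting))
  then show "vgraph K f = vgraph K g" unfolding vgraph_def by simp
qed

lemma is_set_range_vreal: "range vreal \<in> range (elts :: 'v::zfc_universe \<Rightarrow> 'v set)"
proof -
  let ?Q = "range (\<lambda>(a, b, c). vpair (vnat a) (vpair (vnat b) (vnat c)) :: 'v)"
  have "?Q \<in> range elts" by (intro countable_is_set) simp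
  then have "{y. elts y \<subseteq> ?Q} \<in> range elts" by (rule power_ax)
  moreover have "range vreal \<subseteq> {y. elts y \<subseteq> ?Q}"
    by (force simp: elts_vreal intro: range_eqI[of _ _ "(a, b, c)" for a b c])
  ultimately show ?thesis using is_set_subset by blast
qed

lemma is_set_range_vgraph: "range (vgraph K) \<in> range (elts :: 'v::zfc_universe \<Rightarrow> 'v set)"
proof -
  let ?P = "\<Union>x\<in>elts K. vpair x ` range vreal"
  have "?P \<in> range elts"
    by (rule is_set_UN) (simp_all add: replacement[OF is_set_range_vreal])
  then have "{y. elts y \<subseteq> ?P} \<in> range elts" by (rule power_ax)
  moreover have "range (vgraph K) \<subseteq> {y. elts y \<subseteq> ?P}" by (fastforce simp: elts_vgraph)
  ultimately show ?thesis using is_set_subset by blast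
qed

section \<open>From Property B to an embedding\<close>

section \<open>Embedding by a separating family\<close>

text \<open>Coordinates must be indexed by a set of the universe, hence by graphs. Functions that
  differ only off \<open>K\<close> share a graph, so \<open>dec\<close> picks one member of the
  family for each graph. A continuous injection of a compact space into a Hausdorff space is an
  embedding.\<close>

lemma kappa_Corson_if_family:
  fixes \<kappa> K :: "'v::zfc_universe" and T :: "'v topology"
  assumes T: "topspace T = elts K" "compact_space T" "Hausdorff_space T"
    and cont: "\<And>g. g \<in> \<G> \<Longrightarrow> continuous_map T euclideanreal g"
    and range: "\<And>g x. g \<in> \<G> \<Longrightarrow> g x \<in> {0..1}"
    and sep: "\<And>x y. x \<in> elts K \<Longrightarrow> y \<in> elts K \<Longrightarrow> (\<And>g. g \<in> \<G> \<Longrightarrow> g x = g y) \<Longrightarrow> x = y"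
    and supp: "\<And>x. x \<in> elts K \<Longrightarrow> {g \<in> \<G>. g x \<noteq> 0} \<prec> elts \<kappa>"
  shows "kappa_Corson \<kappa> T"
proof -
  define S where "S = vset (vgraph K ` \<G>)"
  have eS: "elts S = vgraph K ` \<G>"
    unfolding S_def by (rule elts_vset[OF is_set_subset[OF _ is_set_range_vgraph]]) auto
  define dec where "dec s = (SOME g. g \<in> \<G> \<and> vgraph K g = s)" for s
  have dec: "dec s \<in> \<G>" "vgraph K (dec s) = s" if "s \<in> elts S" for s
  proof -
    have "\<exists>g. g \<in> \<G> \<and> vgraph K g = s" using that unfolding eS by auto
    then have "dec s \<in> \<G> \<and> vgraph K (dec s) = s" unfolding dec_def by (rule someI_ex)
    then show "dec s \<in> \<G>" "vgraph K (dec s) = s" by auto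
  qed
  define e where "e x = (\<lambda>s\<in>elts S. dec s x)" for x
  let ?\<Sigma> = "Sigma_space \<kappa> S"
  have "continuous_map T ?\<Sigma> e"
    unfolding Sigma_space_def continuous_map_in_subtopology
  proof
    show "continuous_map T (product_topology (\<lambda>_. top_of_set {0..1}) (elts S)) e"
      unfolding continuous_map_componentwise
    proof (intro conjI ballI)
      show "e ` topspace T \<subseteq> extensional (elts S)" by (auto simp: e_def)
      show "continuous_map T (top_of_set {0..1}) (\<lambda>x. e x s)" if s: "s \<in> elts S" for s
      proof -
        have "continuous_map T (top_of_set {0..1}) (dec s)"
          unfolding continuous_map_in_subtopology
          using cont[OF dec(1)[OF s]] range[OF dec(1)[OF s]] by blast
        then show ?thesis using s by (simp add: e_def)
      qed
    qed
    have "{s \<in> elts S. e x s \<noteq> 0} \<prec> elts \<kappa>" if x: "x \<in> elts K" for x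
    proof -
      have "inj_on dec {s \<in> elts S. e x s \<noteq> 0}"
        by (rule inj_on_inverseI[of _ "vgraph K"]) (simp add: dec)
      moreover have "dec ` {s \<in> elts S. e x s \<noteq> 0} \<subseteq> {g \<in> \<G>. g x \<noteq> 0}"
        using dec by (auto simp: e_def)
      ultimately have "{s \<in> elts S. e x s \<noteq> 0} \<lesssim> {g \<in> \<G>. g x \<noteq> 0}"
        unfolding lepoll_def by blast
      then show ?thesis using supp[OF x] by (rule lesspoll_trans1)
    qed
    then show "e \<in> topspace T \<rightarrow> {x. {\<alpha> \<in> elts S. x \<alpha> \<noteq> 0} \<prec> elts \<kappa>}" by (auto simp: T(1))
  qed
  moreover have "Hausdorff_space ?\<Sigma>"
    unfolding Sigma_space_def
    by (intro Hausdorff_space_subtopology) (simp add: Hausdorff_space_product_topology Hausdorff_space_subtopology)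
  moreover have "inj_on e (topspace T)"
  proof (rule inj_onI)
    fix x y assume xy: "x \<in> topspace T" "y \<in> topspace T" "e x = e y"
    show "x = y"
    proof (rule sep)
      fix g assume g: "g \<in> \<G>"
      then have s: "vgraph K g \<in> elts S" by (simp add: eS)
      then have "dec (vgraph K g) x = dec (vgraph K g) y"
        using fun_cong[OF xy(3), of "vgraph K g"] by (simp add: e_def)
      then show "g x = g y" using dec(2)[OF s] xy(1,2) T(1) by (auto simp: vgraph_eq_iff)
    qed (use xy T(1) in auto)
  qed
  ultimately have "embedding_map T ?\<Sigma> e"
    using T(2) by (meson continuous_imp_closed_map injective_closed_imp_embedding_map)
  then show ?thesis using T by (auto simp: kappa_Corson_def)
qed

section \<open>Property \<open>\<BB>\<^sub>\<kappa>\<close> yields the embedding\<close>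

lemma topology_code_exists:
  fixes K :: "'v::zfc_universe"
  assumes "topspace T = elts K"
  shows "\<exists>B. openin T = arbitrary union_of (\<lambda>U. U \<in> elts ` elts B)"
proof -
  define B where "B = vset {y. elts y \<subseteq> elts K \<and> openin T (elts y)}"
  have "{y. elts y \<subseteq> elts K \<and> openin T (elts y)} \<in> range elts"
    by (rule is_set_subset[OF _ power_ax[OF is_set_elts[of K]]]) auto
  then have eB: "elts B = {y. elts y \<subseteq> elts K \<and> openin T (elts y)}"
    unfolding B_def by (rule elts_vset)
  have op: "U \<in> elts ` elts B \<longleftrightarrow> openin T U" for U
  proof
    assume U: "openin T U"
    then have sub: "U \<subseteq> elts K" using openin_subset assms by metis
    then have "elts (vset U) = U" by (intro elts_vset is_set_subset[OF _ is_set_elts])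
    then show "U \<in> elts ` elts B" using sub U by (intro image_eqI[of _ _ "vset U"]) (auto simp: eB)
  qed (auto simp: eB)
  have "openin T = arbitrary union_of (\<lambda>U. U \<in> elts ` elts B)"
    unfolding op by (auto simp: fun_eq_iff union_of_def arbitrary_def openin_Union
        intro: exI[of _ "{U}" for U])
  then show ?thesis by blast
qed

lemma kappa_Corson_if_property_B:
  fixes \<kappa> K :: "'v::zfc_universe" and T :: "'v topology"
  assumes \<kappa>: "regular_cardinal \<kappa>" "uncountable (elts \<kappa>)"
    and T: "topspace T = elts K" "compact_space T" "Hausdorff_space T"
    and B: "property_B \<kappa> K T"
  shows "kappa_Corson \<kappa> T"
proof -
  obtain \<theta>\<^sub>0 where \<theta>\<^sub>0: "cardinal \<theta>\<^sub>0" and separates: "\<And>\<theta> M x y. regular_cardinal \<theta> \<Longrightarrow> elts \<theta>\<^sub>0 \<subseteq> elts \<theta> \<Longrightarrow>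
      stable_submodel \<kappa> \<theta> M \<Longrightarrow> space_in_model K T M \<Longrightarrow> M \<prec> elts \<kappa> \<Longrightarrow>
      x \<in> T closure_of (elts K \<inter> M) \<Longrightarrow> y \<in> T closure_of (elts K \<inter> M) \<Longrightarrow>
      model_equiv K T M x y \<Longrightarrow> x = y"
    using B unfolding property_B_def by blast
  obtain B where B: "openin T = arbitrary union_of (\<lambda>U. U \<in> elts ` elts B)"
    using topology_code_exists[OF T(1)] by blast
  \<comment> \<open>The transitive closures force \<kappa>, \<open>K\<close> and \<open>B\<close>
    into H(\<theta>); the first part puts \<theta> in the range where Property B applies.\<close>
  define D where "D = elts \<theta>\<^sub>0 \<union> (trans_closure \<kappa> \<union> (trans_closure K \<union> trans_closure B))"
  have "D \<in> range elts"
    unfolding D_def by (intro is_set_Un is_set_trans_closure is_set_elts)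
  moreover have "infinite D"
    using \<kappa>(1) elts_subset_trans_closure[of \<kappa>] unfolding D_def regular_cardinal_def
    by (meson infinite_super sup_ge1 sup_ge2 order_trans)
  ultimately obtain \<theta> :: 'v where \<theta>: "regular_cardinal \<theta>" "D \<prec> elts \<theta>"
    using regular_cardinal_above by blast
  have sub: "Y \<prec> elts \<theta>" if "Y \<subseteq> D" for Y
    using lesspoll_trans1[OF subset_imp_lepoll[OF that] \<theta>(2)] .
  have \<theta>\<^sub>0\<theta>: "elts \<theta>\<^sub>0 \<subseteq> elts \<theta>"
    using \<theta>(1) by (intro cardinal_subset \<theta>\<^sub>0 sub) (auto simp: D_def regular_cardinal_def)
  define H where "H = Hset \<theta>"
  have inH: "\<kappa> \<in> H" "K \<in> H" "B \<in> H"
    unfolding H_def Hset_def by (auto simp: D_def intro!: sub)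
  have H_mem: "y \<in> H" if "x \<in> H" "y \<in> elts x" for x y
    using that unfolding H_def by (rule Hset_mem)

  \<comment> \<open>Anything that is not the graph of a continuous function codes the zero function,
    so every \<open>fn c\<close> is continuous.\<close>
  define fn where "fn c = (if \<exists>f. continuous_map T euclideanreal f \<and> vgraph K f = c
      then SOME f. continuous_map T euclideanreal f \<and> vgraph K f = c else (\<lambda>_. 0))" for c
  have fn_cont: "continuous_map T euclideanreal (fn c)" for c
    unfolding fn_def by (auto intro: someI2_ex[where Q = "continuous_map T euclideanreal"])
  have fn: "fn (vgraph K f) x = f x" if f: "continuous_map T euclideanreal f" and x: "x \<in> elts K" for f x
  proof -
    have ex: "\<exists>g. continuous_map T euclideanreal g \<and> vgraph K g = vgraph K f" using f by blast
    then have "vgraph K (fn (vgraph K f)) = vgraph K f"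
      using someI_ex[OF ex] by (simp add: fn_def)
    then show ?thesis using x by (simp add: vgraph_eq_iff)
  qed
  \<comment> \<open>A point of \<open>K\<close> whose values lie in prescribed rational intervals.
    Rational bounds leave only countably many choices for each list of codes; \<open>K\<close> is
    the default and lies in H(\<theta>).\<close>
  define dens where "dens cs qs = (let P = \<lambda>z. z \<in> elts K \<and>
      (\<forall>i<length cs. of_rat (fst (qs ! i)) < fn (cs ! i) z \<and> fn (cs ! i) z < of_rat (snd (qs ! i)))
      in if Ex P then Eps P else K)" for cs and qs :: "(rat \<times> rat) list"
  have dens_in: "dens cs qs \<in> insert K (elts K)" for cs qs
    unfolding dens_def Let_def by (auto intro: someI2_ex[where Q = "\<lambda>z. z \<in> elts K"])
  have dens_H: "dens cs qs \<in> H" for cs qs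
    using dens_in[of cs qs] H_mem[OF inH(2)] inH(2) by auto
  \<comment> \<open>The rules for Skolem functions, constants, initial segments of \<kappa> and
    density. A one-element list with an ordinal below \<kappa> adds the elements of that ordinal,
    which yields \<kappa>-stability.\<close>
  define G where "G xs = range (skolem H K xs) \<union> ({K, B, \<kappa>} \<union>
      ((case xs of [\<alpha>] \<Rightarrow> if \<alpha> \<in> elts \<kappa> then elts \<alpha> else {} | _ \<Rightarrow> {}) \<union> range (dens xs)))" for xs
  have GH: "G xs \<subseteq> H" for xs
  proof -
    have "elts \<alpha> \<subseteq> H" if "\<alpha> \<in> elts \<kappa>" for \<alpha> using H_mem[OF H_mem[OF inH(1) that]] by blast
    then show ?thesis
      unfolding G_def using inH skolem_in[OF inH(2)] dens_H
      by (auto split: list.splits)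
  qed

  let ?r = "|elts \<kappa>|"
  have inf: "infinite (elts \<kappa>)" using \<kappa>(1) by (simp add: regular_cardinal_def)
  have nat_less: "|UNIV :: nat set| <o ?r"
  proof -
    have "\<not> elts \<kappa> \<lesssim> (UNIV :: nat set)" using \<kappa>(2) by (auto simp: countable_def lepoll_def)
    then have "\<not> |elts \<kappa>| \<le>o |UNIV :: nat set|" by (simp add: lepoll_iff_ordLeq)
    then show ?thesis by (simp add: not_ordLeq_iff_ordLess card_of_Well_order)
  qed
  interpret ss: small_sets ?r
    by standard (rule stable_regular_cardinal[OF \<kappa>(1)] nat_less)+
  have \<kappa>_elem: "|elts \<alpha>| <o ?r" if "\<alpha> \<in> elts \<kappa>" for \<alpha>
    using \<kappa>(1) that by (simp add: regular_cardinal_def cardinal_def lesspoll_iff_ordLess)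
  interpret es: elementary_separation ?r T fn G
  proof
    show "Card_order ?r" by (rule card_of_Card_order)
    show "compact_space T" "Hausdorff_space T" by (rule T)+
    show "continuous_map T euclideanreal (fn c)" for c by (rule fn_cont)
    show "|G xs| <o ?r" for xs
    proof -
      have "|case xs of [\<alpha>] \<Rightarrow> if \<alpha> \<in> elts \<kappa> then elts \<alpha> else {} | _ \<Rightarrow> {}| <o ?r"
        using \<kappa>_elem by (auto split: list.split intro: ss.small_countable)
      then show ?thesis unfolding G_def
        by (intro ss.small_Un ss.small_countable[of "range _"] ss.small_countable[of "{K, B, \<kappa>}"]) simp_all
    qed
  next
    fix X x y
    assume X: "rule_closed G X" "|X| <o ?r"
      and x: "x \<in> T closure_of (topspace T \<inter> X)" and y: "y \<in> T closure_of (topspace T \<inter> X)"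
      and eq: "\<And>c. c \<in> X \<Longrightarrow> fn c x = fn c y"
    \<comment> \<open>A closed set may have elements outside H(\<theta>). Since all rules take
      values in \<open>H\<close>, the intersection is still closed, and it keeps all points of
      \<open>K\<close> in \<open>X\<close>.\<close>
    define M where "M = X \<inter> H"
    have GM: "G xs \<subseteq> M" if "set xs \<subseteq> M" for xs
      using X(1) that GH unfolding rule_closed_def M_def by blast
    have KM: "K \<in> M" "B \<in> M" "\<kappa> \<in> M" using GM[of "[]"] by (auto simp: G_def)
    have "elementary_submodel M H"
    proof (rule elementary_submodel_if_skolem_closed)
      show "skolem H K xs p \<in> M" if "set xs \<subseteq> M" for xs p
        using GM[OF that] by (auto simp: G_def)
    qed (use KM in \<open>auto simp: M_def\<close>)
    moreover have "elts \<alpha> \<subseteq> M" if "\<alpha> \<in> elts \<kappa> \<inter> M" for \<alpha>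
      using GM[of "[\<alpha>]"] that by (auto simp: G_def)
    ultimately have stable: "stable_submodel \<kappa> \<theta> M"
      unfolding stable_submodel_def H_def using KM by auto
    have "M \<prec> elts \<kappa>"
      unfolding lesspoll_iff_ordLess M_def by (rule ss.small_subset[OF Int_lower1 X(2)])
    moreover have "space_in_model K T M"
      unfolding space_in_model_def using KM B by blast
    moreover have "topspace T \<inter> X = elts K \<inter> M"
      using H_mem[OF inH(2)] by (auto simp: T(1) M_def)
    moreover have "x \<in> elts K" "y \<in> elts K"
      using x y closure_of_subset_topspace[of T] T(1) by blast+
    then have "model_equiv K T M x y"
      unfolding model_equiv_def using eq fn by (fastforce simp: M_def)
    ultimately show "x = y"
      using separates[OF \<theta>(1) \<theta>\<^sub>0\<theta> stable] x y by metis
  next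
    fix X x C and \<epsilon> :: real
    assume X: "rule_closed G X" and x: "x \<in> topspace T" and C: "finite C" "C \<subseteq> X" and \<epsilon>: "0 < \<epsilon>"
    obtain cs where cs: "set cs = C" using finite_list[OF C(1)] by blast
    have "\<exists>q. fn c x - \<epsilon> < of_rat (fst q) \<and> of_rat (fst q) < fn c x \<and>
        fn c x < of_rat (snd q) \<and> of_rat (snd q) < fn c x + \<epsilon>" for c
      using of_rat_dense[of "fn c x - \<epsilon>" "fn c x"] of_rat_dense[of "fn c x" "fn c x + \<epsilon>"] \<epsilon> by auto
    then obtain q :: "'v \<Rightarrow> rat \<times> rat" where q: "\<And>c. fn c x - \<epsilon> < of_rat (fst (q c)) \<and>
        of_rat (fst (q c)) < fn c x \<and> fn c x < of_rat (snd (q c)) \<and> of_rat (snd (q c)) < fn c x + \<epsilon>"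
      by metis
    define qs where "qs = map q cs"
    let ?P = "\<lambda>z. z \<in> elts K \<and>
      (\<forall>i<length cs. of_rat (fst (qs ! i)) < fn (cs ! i) z \<and> fn (cs ! i) z < of_rat (snd (qs ! i)))"
    have ex: "Ex ?P" using x q by (auto simp: T(1) qs_def)
    then have "dens cs qs = Eps ?P" by (simp add: dens_def)
    then have z: "?P (dens cs qs)" using someI_ex[OF ex] by simp
    have "dens cs qs \<in> G cs" by (simp add: G_def)
    then have "dens cs qs \<in> X" using X C(2) cs unfolding rule_closed_def by blast
    moreover have "\<bar>fn c (dens cs qs) - fn c x\<bar> < \<epsilon>" if c: "c \<in> C" for c
    proof -
      obtain i where i: "i < length cs" "c = cs ! i" using c unfolding cs[symmetric] by (auto simp: in_set_conv_nth)
      then have "of_rat (fst (q c)) < fn c (dens cs qs) \<and> fn c (dens cs qs) < of_rat (snd (q c))"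
        using z by (simp add: qs_def)
      then show ?thesis using q[of c] by linarith
    qed
    ultimately show "\<exists>z\<in>topspace T \<inter> X. \<forall>c\<in>C. \<bar>fn c z - fn c x\<bar> < \<epsilon>"
      using z by (auto simp: T(1))
  qed

  \<comment> \<open>Generating from all points makes \<open>cl X\<close> the whole space.\<close>
  define X where "X = generated G (elts K)"
  obtain \<F> where \<F>: "es.separating_family X \<F>"
    using es.separating_family_exists[OF rule_closed_generated] unfolding X_def by (rule exE)
  have "topspace T \<inter> X = topspace T" unfolding X_def T(1) by (rule Int_absorb2[OF generated_superset])
  then have cl: "es.cl X = elts K" by (simp add: T(1)[symmetric])
  \<comment> \<open>\<open>p\<close> vanishes on nonpositive numbers and maps the positive ones
    injectively into the unit interval. Replacing \<open>f\<close> by \<open>p\<close> of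
    \<open>f\<close> and of \<open>- f\<close> bounds the values, keeps the separation and creates
    no new nonzero points.\<close>
  define p where "p t = max t 0 / (1 + max t 0)" for t :: real
  have p01: "p t \<in> {0..1}" for t by (auto simp: p_def)
  have p_cont: "continuous_on UNIV p"
  proof -
    have "1 + max t 0 \<noteq> 0" for t :: real by (auto simp: max_def)
    then show ?thesis unfolding p_def by (intro continuous_intros) auto
  qed
  have p_nz: "p t \<noteq> 0 \<Longrightarrow> t \<noteq> 0" for t by (auto simp: p_def)
  have p_inj: "s = t" if "p s = p t" "p (- s) = p (- t)" for s t
    using that unfolding p_def by (auto simp: divide_simps max_def algebra_simps split: if_splits)
  define \<G> where "\<G> = (\<lambda>f x. p (f x)) ` \<F> \<union> (\<lambda>f x. p (- f x)) ` \<F>"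
  show ?thesis
  proof (rule kappa_Corson_if_family[OF T])
    fix g assume "g \<in> \<G>"
    moreover have "continuous_map T euclideanreal (\<lambda>x. p (f x))"
      "continuous_map T euclideanreal (\<lambda>x. p (- f x))" if "f \<in> \<F>" for f
    proof -
      have f: "continuous_map T euclideanreal f" using \<F> that by (auto simp: es.separating_family_def)
      have pc: "continuous_map euclideanreal euclideanreal p" using p_cont by simp
      show "continuous_map T euclideanreal (\<lambda>x. p (f x))"
        using continuous_map_compose[OF f pc] by (simp add: o_def)
      show "continuous_map T euclideanreal (\<lambda>x. p (- f x))"
        using continuous_map_compose[OF continuous_map_minus[OF f] pc] by (simp add: o_def)
    qed
    ultimately show "continuous_map T euclideanreal g" by (auto simp: \<G>_def)
  next
    show "g x \<in> {0..1}" if "g \<in> \<G>" for g x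
      using that unfolding \<G>_def by (elim UnE imageE) (simp_all only: p01)
  next
    fix x y assume xy: "x \<in> elts K" "y \<in> elts K" and eq: "\<And>g. g \<in> \<G> \<Longrightarrow> g x = g y"
    have "f x = f y" if "f \<in> \<F>" for f
    proof (rule p_inj)
      have "(\<lambda>x. p (f x)) \<in> \<G>" "(\<lambda>x. p (- f x)) \<in> \<G>"
        unfolding \<G>_def using that by blast+
      from this[THEN eq] show "p (f x) = p (f y)" "p (- f x) = p (- f y)" by auto
    qed
    then show "x = y" using \<F> xy unfolding es.separating_family_def cl by blast
  next
    fix x assume x: "x \<in> elts K"
    let ?F = "{f \<in> \<F>. f x \<noteq> 0}"
    have "|?F| <o ?r" using \<F> x by (auto simp: es.separating_family_def T(1))
    then have "|(\<lambda>f x. p (f x)) ` ?F \<union> (\<lambda>f x. p (- f x)) ` ?F| <o ?r"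
      by (intro ss.small_Un ss.small_image)
    moreover have "{g \<in> \<G>. g x \<noteq> 0} \<subseteq> (\<lambda>f x. p (f x)) ` ?F \<union> (\<lambda>f x. p (- f x)) ` ?F"
      unfolding \<G>_def using p_nz by fastforce
    ultimately show "{g \<in> \<G>. g x \<noteq> 0} \<prec> elts \<kappa>"
      unfolding lesspoll_iff_ordLess by (rule ss.small_subset[rotated])
  qed
qed

section \<open>Definability: finding objects inside the submodel\<close>

section \<open>Definability over an elementary submodel\<close>

primrec rename :: "(nat \<Rightarrow> nat) \<Rightarrow> fm \<Rightarrow> fm" where
  "rename \<rho> (Mem i j) = Mem (\<rho> i) (\<rho> j)"
| "rename \<rho> (Eq i j) = Eq (\<rho> i) (\<rho> j)"
| "rename \<rho> (Neg \<phi>) = Neg (rename \<rho> \<phi>)"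
| "rename \<rho> (Conj \<phi> \<psi>) = Conj (rename \<rho> \<phi>) (rename \<rho> \<psi>)"
| "rename \<rho> (Exists i \<phi>) = Exists (\<rho> i) (rename \<rho> \<phi>)"

lemma sats_rename:
  assumes \<rho>: "inj \<rho>" shows "sats A (rename \<rho> \<phi>) s = sats A \<phi> (s \<circ> \<rho>)"
proof (induction \<phi> arbitrary: s)
  case (Exists i \<phi>)
  have "s(\<rho> i := a) \<circ> \<rho> = (s \<circ> \<rho>)(i := a)" for a
    using \<rho> by (auto simp: fun_eq_iff inj_eq)
  then show ?case by (simp only: rename.simps sats.simps Exists.IH)
qed auto

text \<open>Even variables are the arguments of the predicate, odd ones are parameters.\<close>

definition interleave :: "(nat \<Rightarrow> 'a) \<Rightarrow> (nat \<Rightarrow> 'a) \<Rightarrow> nat \<Rightarrow> 'a" where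
  "interleave s t n = (if even n then s (n div 2) else t (n div 2))"

text \<open>A semantic notion: rules following the structure of a HOL predicate prove that some
  formula expresses it over \<open>H\<close>, so concrete formulas need not be written down.\<close>

definition definable :: "'v::zfc_universe set \<Rightarrow> 'v set \<Rightarrow> ((nat \<Rightarrow> 'v) \<Rightarrow> bool) \<Rightarrow> bool" where
  "definable M H P \<longleftrightarrow> (\<exists>\<phi> t. range t \<subseteq> M \<and>
     (\<forall>s. range s \<subseteq> H \<longrightarrow> P s = sats H \<phi> (interleave s t)))"

definition is_term :: "'v set \<Rightarrow> ((nat \<Rightarrow> 'v) \<Rightarrow> 'v) \<Rightarrow> bool" where
  "is_term M x \<longleftrightarrow> (\<exists>i. x = (\<lambda>s. s i)) \<or> (\<exists>c\<in>M. x = (\<lambda>_. c))"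

lemma is_termE:
  assumes "is_term M x" obtains i where "x = (\<lambda>s. s i)" | c where "c \<in> M" "x = (\<lambda>_. c)"
  using assms by (auto simp: is_term_def)

named_theorems definability

lemma is_term_var [definability]: "is_term M (\<lambda>s. s i)"
  by (auto simp: is_term_def)

lemma is_term_const [definability]: "c \<in> M \<Longrightarrow> is_term M (\<lambda>_. c)"
  by (auto simp: is_term_def)

lemma definable_cong:
  assumes "definable M H P" "\<And>s. range s \<subseteq> H \<Longrightarrow> P s = Q s" shows "definable M H Q"
  using assms unfolding definable_def by metis

lemma definable_atom:
  assumes x: "is_term M x" and y: "is_term M y" and ne: "M \<noteq> {}"
    and R: "\<And>i j s. sats H (\<phi> i j) s = R (s i) (s j)"
  shows "definable M H (\<lambda>s. R (x s) (y s))"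
proof -
  obtain m where m: "m \<in> M" using ne by blast
  have "\<exists>i j t. range t \<subseteq> M \<and> (\<forall>s. x s = interleave s t i \<and> y s = interleave s t j)"
    using x
  proof (cases rule: is_termE)
    case x: (1 i)
    from y show ?thesis
    proof (cases rule: is_termE)
      case (1 j)
      then show ?thesis using x m
        by (intro exI[of _ "2 * i"] exI[of _ "2 * j"] exI[of _ "\<lambda>_. m"]) (auto simp: interleave_def)
    next
      case (2 c)
      then show ?thesis using x
        by (intro exI[of _ "2 * i"] exI[of _ "1"] exI[of _ "\<lambda>_. c"]) (auto simp: interleave_def)
    qed
  next
    case x: (2 c)
    from y show ?thesis
    proof (cases rule: is_termE)
      case (1 j)
      then show ?thesis using x
        by (intro exI[of _ "1"] exI[of _ "2 * j"] exI[of _ "\<lambda>_. c"]) (auto simp: interleave_def)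
    next
      case (2 d)
      then show ?thesis using x
        by (intro exI[of _ "1"] exI[of _ "3"] exI[of _ "\<lambda>n. if n = 0 then c else d"])
          (auto simp: interleave_def)
    qed
  qed
  then obtain i j t where "range t \<subseteq> M" "\<And>s. x s = interleave s t i \<and> y s = interleave s t j"
    by blast
  then show ?thesis unfolding definable_def
    by (intro exI[of _ "\<phi> i j"] exI[of _ t]) (simp add: R)
qed

lemma definable_not [definability]: "definable M H P \<Longrightarrow> definable M H (\<lambda>s. \<not> P s)"
  unfolding definable_def by (metis sats.simps(3))

lemma definable_conj [definability]:
  assumes "definable M H P" "definable M H Q" shows "definable M H (\<lambda>s. P s \<and> Q s)"
proof -
  obtain \<phi> t \<psi> u where t: "range t \<subseteq> M" "\<And>s. range s \<subseteq> H \<Longrightarrow> P s = sats H \<phi> (interleave s t)"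
    and u: "range u \<subseteq> M" "\<And>s. range s \<subseteq> H \<Longrightarrow> Q s = sats H \<psi> (interleave s u)"
    using assms unfolding definable_def by blast
  \<comment> \<open>The two formulas bring their own parameters. \<open>\<rho> e\<close> fixes the
    arguments and sends parameter \<open>k\<close> to parameter \<open>2 * k + e\<close>, its place
    in \<open>interleave t u\<close>.\<close>
  define \<rho> where "\<rho> e n = (if even n then n else 2 * (2 * (n div 2) + e) + 1)" for e n :: nat
  have inj: "inj (\<rho> e)" for e
  proof (rule injI)
    fix m n assume eq: "\<rho> e m = \<rho> e n"
    have "even (\<rho> e k) = even k" for k by (simp add: \<rho>_def)
    then have "even m = even n" using eq by metis
    then show "m = n" using eq unfolding \<rho>_def
      by (auto split: if_splits elim!: oddE)
  qed
  have "interleave s (interleave t u) \<circ> \<rho> 0 = interleave s t"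
    "interleave s (interleave t u) \<circ> \<rho> 1 = interleave s u" for s :: "nat \<Rightarrow> 'a"
    by (auto simp: interleave_def \<rho>_def fun_eq_iff elim!: oddE)
  then have "sats H (Conj (rename (\<rho> 0) \<phi>) (rename (\<rho> 1) \<psi>)) (interleave s (interleave t u)) = (P s \<and> Q s)"
    if "range s \<subseteq> H" for s
    using t(2)[OF that] u(2)[OF that] by (simp add: sats_rename[OF inj])
  moreover have "range (interleave t u) \<subseteq> M" using t(1) u(1) by (auto simp: interleave_def)
  ultimately show ?thesis unfolding definable_def by metis
qed

lemma definable_ex [definability]:
  assumes "definable M H (\<lambda>s. P (s 0) (\<lambda>n. s (Suc n)))"
  shows "definable M H (\<lambda>s. \<exists>a\<in>H. P a s)"
proof -
  obtain \<phi> t where t: "range t \<subseteq> M"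
    "\<And>s. range s \<subseteq> H \<Longrightarrow> P (s 0) (\<lambda>n. s (Suc n)) = sats H \<phi> (interleave s t)"
    using assms unfolding definable_def by blast
  define N where "N = var_bound \<phi>"
  \<comment> \<open>The premise has the bound variable at argument 0 and the others shifted up by
    one, while formulas name their variables. \<open>\<rho>\<close> undoes the shift for the
    variables that can occur and moves the bound one to the freed slot \<open>2 * N\<close>; the
    rest stays fixed to keep \<open>\<rho>\<close> injective.\<close>
  define \<rho> where "\<rho> n = (if odd n then n else if n = 0 then 2 * N else if n \<le> 2 * N then n - 2 else n)" for n
  have inj: "inj \<rho>"
    by (rule injI) (auto simp: \<rho>_def split: if_splits elim!: evenE oddE, presburger+)
  have "sats H (rename \<rho> \<phi>) ((interleave s t)(2 * N := a)) = P a s" if s: "range s \<subseteq> H" and a: "a \<in> H" for s a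
  proof -
    have "sats H (rename \<rho> \<phi>) ((interleave s t)(2 * N := a)) = sats H \<phi> ((interleave s t)(2 * N := a) \<circ> \<rho>)"
      by (rule sats_rename[OF inj])
    also have "\<dots> = sats H \<phi> (interleave (case_nat a s) t)"
    proof (rule sats_agree)
      fix n assume "n < var_bound \<phi>"
      then have n: "n < N" by (simp add: N_def)
      show "((interleave s t)(2 * N := a) \<circ> \<rho>) n = interleave (case_nat a s) t n"
      proof (cases "odd n")
        case True
        then show ?thesis by (auto simp: \<rho>_def interleave_def)
      next
        case False
        then obtain k where k: "n = 2 * k" by blast
        show ?thesis
        proof (cases k)
          case 0
          then show ?thesis using k by (simp add: \<rho>_def interleave_def)
        next
          case (Suc j)
          then have "\<rho> n = 2 * j" "j \<noteq> N" using k n by (auto simp: \<rho>_def)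
          then show ?thesis using k Suc by (simp add: interleave_def)
        qed
      qed
    qed
    also have "\<dots> = P a s"
      using t(2)[of "case_nat a s"] s a by (auto simp: image_subset_iff split: nat.splits)
    finally show ?thesis .
  qed
  then have "\<forall>s. range s \<subseteq> H \<longrightarrow> (\<exists>a\<in>H. P a s) = sats H (Exists (2 * N) (rename \<rho> \<phi>)) (interleave s t)"
    by simp
  then show ?thesis unfolding definable_def using t(1) by blast
qed

text \<open>\<open>big\<close> makes \<theta> exceed the continuum; in particular countable subsets
  of H(\<theta>) are elements of it.\<close>

locale submodel =
  fixes \<theta> :: "'v::zfc_universe" and M :: "'v set"
  assumes reg: "regular_cardinal \<theta>" and elem: "elementary_submodel M (Hset \<theta>)"
    and big: "range (vreal :: real \<Rightarrow> 'v) \<prec> elts \<theta>"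
begin

abbreviation H :: "'v set" where "H \<equiv> Hset \<theta>"
abbreviation dfn :: "((nat \<Rightarrow> 'v) \<Rightarrow> bool) \<Rightarrow> bool" where "dfn \<equiv> definable M H"

lemma M_H: "c \<in> M \<Longrightarrow> c \<in> H" and M_ne: "M \<noteq> {}"
  using elem by (auto simp: elementary_submodel_def)

text \<open>The existential statement has parameters in \<open>M\<close>, so it passes down to
  \<open>M\<close>; a witness found there satisfies the formula in \<open>H\<close> again.\<close>

lemma witness_in_M:
  assumes P: "dfn (\<lambda>s. P (s 0))" and a: "a \<in> H" "P a" shows "\<exists>a\<in>M. P a"
proof -
  obtain \<phi> t where t: "range t \<subseteq> M" "\<And>s. range s \<subseteq> H \<Longrightarrow> P (s 0) = sats H \<phi> (interleave s t)"
    using P unfolding definable_def by blast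
  obtain m where m: "m \<in> M" using M_ne by blast
  define s where "s b = (\<lambda>_::nat. m)(0 := b)" for b
  have sH: "range (s b) \<subseteq> H" if "b \<in> H" for b using that m M_H by (auto simp: s_def)
  have il: "interleave (s b) t = (interleave (s m) t)(0 := b)" for b
    by (auto simp: s_def interleave_def fun_eq_iff)
  have r: "range (interleave (s b) t) \<subseteq> M" if "b \<in> M" for b
    using that m t(1) by (auto simp: interleave_def s_def)
  have el: "sats M \<psi> u = sats H \<psi> u" if "range u \<subseteq> M" for \<psi> u
    using elem that by (simp add: elementary_submodel_def)
  have "sats H (Exists 0 \<phi>) (interleave (s m) t)"
    using a t(2)[OF sH[OF a(1)]] il[of a] by (auto simp: s_def intro!: bexI[of _ a])
  then have "sats M (Exists 0 \<phi>) (interleave (s m) t)" unfolding el[OF r[OF m]] .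
  then obtain b where b: "b \<in> M" "sats M \<phi> (interleave (s b) t)"
    unfolding sats.simps il[symmetric] by blast
  then have "P (s b 0)" using t(2)[OF sH[OF M_H[OF b(1)]]] el[OF r[OF b(1)]] by simp
  then show ?thesis using b(1) by (auto simp: s_def)
qed

lemma unique_in_M:
  assumes "dfn (\<lambda>s. P (s 0))" "a \<in> H" "P a" "\<And>b. b \<in> H \<Longrightarrow> P b \<Longrightarrow> b = a" shows "a \<in> M"
  using witness_in_M[OF assms(1-3)] assms(4) M_H by blast

lemma dfn_mem [definability]: "is_term M x \<Longrightarrow> is_term M y \<Longrightarrow> dfn (\<lambda>s. x s \<in> elts (y s))"
  by (rule definable_atom[where \<phi> = Mem, OF _ _ M_ne]) auto

lemma dfn_eq [definability]: "is_term M x \<Longrightarrow> is_term M y \<Longrightarrow> dfn (\<lambda>s. x s = y s)"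
  by (rule definable_atom[where \<phi> = Eq, OF _ _ M_ne]) auto

lemma dfn_const [definability]: "dfn (\<lambda>_. b)"
proof (cases b)
  case True
  have "dfn (\<lambda>s. s 0 = s 0)" by (intro definability)
  then show ?thesis using True by simp
next
  case False
  have "dfn (\<lambda>s. \<not> (s 0 = s 0))" by (intro definability)
  then show ?thesis using False by simp
qed

lemma dfn_disj [definability]:
  assumes "dfn P" "dfn Q" shows "dfn (\<lambda>s. P s \<or> Q s)"
  by (rule definable_cong[OF definable_not[OF definable_conj[OF assms[THEN definable_not]]]]) blast

lemma dfn_imp [definability]:
  assumes "dfn P" "dfn Q" shows "dfn (\<lambda>s. P s \<longrightarrow> Q s)"
  by (rule definable_cong[OF dfn_disj[OF definable_not[OF assms(1)] assms(2)]]) blast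

lemma dfn_iff [definability]:
  assumes "dfn P" "dfn Q" shows "dfn (\<lambda>s. P s \<longleftrightarrow> Q s)"
  by (rule definable_cong[OF definable_conj[OF dfn_imp[OF assms] dfn_imp[OF assms(2,1)]]]) blast

lemma dfn_all [definability]:
  assumes "dfn (\<lambda>s. P (s 0) (\<lambda>n. s (Suc n)))" shows "dfn (\<lambda>s. \<forall>a\<in>H. P a s)"
  by (rule definable_cong[OF definable_not[OF definable_ex[OF definable_not[OF assms]]]]) blast

text \<open>\<open>H\<close> is transitive, so a quantifier bounded by one of its elements is a
  quantifier over \<open>H\<close>.\<close>

lemma dfn_bex [definability]:
  assumes "is_term M x" "dfn (\<lambda>s. P (s 0) (\<lambda>n. s (Suc n)))"
  shows "dfn (\<lambda>s. \<exists>a\<in>elts (x s). P a s)"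
proof (rule definable_cong)
  show "dfn (\<lambda>s. \<exists>a\<in>H. a \<in> elts (x s) \<and> P a s)"
    using assms(1) by (cases rule: is_termE) (simp_all, (intro definability assms(2); assumption)+)
  show "(\<exists>a\<in>H. a \<in> elts (x s) \<and> P a s) = (\<exists>a\<in>elts (x s). P a s)" if "range s \<subseteq> H" for s
  proof -
    have "x s \<in> H" using assms(1) that M_H by (cases rule: is_termE) auto
    then show ?thesis using Hset_mem by blast
  qed
qed

lemma dfn_ball [definability]:
  assumes "is_term M x" "dfn (\<lambda>s. P (s 0) (\<lambda>n. s (Suc n)))"
  shows "dfn (\<lambda>s. \<forall>a\<in>elts (x s). P a s)"
  by (rule definable_cong[OF definable_not[OF dfn_bex[OF assms(1) definable_not[OF assms(2)]]]]) blast

end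

section \<open>Arithmetic inside the submodel\<close>

definition vsucc :: "'v \<Rightarrow> 'v::zfc_universe" where
  "vsucc n = vset (insert n (elts n))"

lemma elts_vsucc: "elts (vsucc n) = insert n (elts n)"
  unfolding vsucc_def using is_set_Un[OF countable_is_set, of "{n}" "elts n"] by (simp add: elts_vset)

lemma vnat_Suc: "vnat (Suc n) = vsucc (vnat n)"
  by (simp add: vsucc_def vnat.simps)

declare vnat.simps [simp del]

lemma elts_finite: "finite X \<Longrightarrow> elts (vset X) = X"
  by (simp add: elts_vset countable_is_set countable_finite)

lemma elts_vnat_0: "elts (vnat 0) = {}"
  by (simp add: elts_finite vnat.simps)

lemma vnat_mem_iff: "vnat m \<in> elts (vnat n) \<longleftrightarrow> m < n"
  by (auto simp: elts_vnat vnat_inject)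

lemma eq_vsucc_iff: "m = vsucc n \<longleftrightarrow>
  n \<in> elts m \<and> (\<forall>x\<in>elts n. x \<in> elts m) \<and> (\<forall>x\<in>elts m. x = n \<or> x \<in> elts n)"
proof
  assume r: "n \<in> elts m \<and> (\<forall>x\<in>elts n. x \<in> elts m) \<and> (\<forall>x\<in>elts m. x = n \<or> x \<in> elts n)"
  show "m = vsucc n" by (rule extensionality) (use r in \<open>auto simp: elts_vsucc\<close>)
qed (simp add: elts_vsucc)

lemma eq_upair_iff: "w = vset {x, y} \<longleftrightarrow>
  x \<in> elts w \<and> y \<in> elts w \<and> (\<forall>v\<in>elts w. v = x \<or> v = y)"
proof
  assume r: "x \<in> elts w \<and> y \<in> elts w \<and> (\<forall>v\<in>elts w. v = x \<or> v = y)"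
  show "w = vset {x, y}" by (rule extensionality) (use r in \<open>auto simp: elts_finite\<close>)
qed (simp add: elts_finite)

lemma eq_vpair_iff: "p = vpair x y \<longleftrightarrow>
  (\<exists>u\<in>elts p. u = vset {x, x}) \<and> (\<exists>u\<in>elts p. u = vset {x, y}) \<and>
  (\<forall>u\<in>elts p. u = vset {x, x} \<or> u = vset {x, y})"
proof
  assume r: "(\<exists>u\<in>elts p. u = vset {x, x}) \<and> (\<exists>u\<in>elts p. u = vset {x, y}) \<and>
    (\<forall>u\<in>elts p. u = vset {x, x} \<or> u = vset {x, y})"
  show "p = vpair x y" unfolding vpair_def
    by (rule extensionality) (use r in \<open>auto simp: elts_finite\<close>)
qed (simp add: vpair_def elts_finite)

abbreviation vtriple :: "'v \<Rightarrow> 'v \<Rightarrow> 'v \<Rightarrow> 'v::zfc_universe" where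
  "vtriple a b c \<equiv> vpair a (vpair b c)"

abbreviation vfrac :: "nat \<Rightarrow> nat \<Rightarrow> nat \<Rightarrow> 'v::zfc_universe" where
  "vfrac a b c \<equiv> vtriple (vnat a) (vnat b) (vnat c)"

abbreviation frac_val :: "nat \<Rightarrow> nat \<Rightarrow> nat \<Rightarrow> real" where
  "frac_val a b c \<equiv> (real a - real b) / real (Suc c)"

text \<open>Without division and subtraction the order becomes expressible through the graphs of
  addition and multiplication of natural numbers.\<close>

lemma frac_val_less_iff:
  "frac_val a b c < frac_val a' b' c' \<longleftrightarrow>
    a * Suc c' + b' * Suc c < a' * Suc c + b * Suc c'"
proof -
  have "frac_val a b c < frac_val a' b' c' \<longleftrightarrow>
      (real a - real b) * real (Suc c') < (real a' - real b') * real (Suc c)"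
    by (simp add: divide_less_eq less_divide_eq mult.commute)
  also have "\<dots> \<longleftrightarrow> real (a * Suc c' + b' * Suc c) < real (a' * Suc c + b * Suc c')"
    unfolding of_nat_add of_nat_mult by (simp only: left_diff_distrib) linarith
  finally show ?thesis by (simp only: of_nat_less_iff)
qed

lemma frac_val_dense:
  assumes "r < s" shows "\<exists>a b c. r < frac_val a b c \<and> frac_val a b c < s"
proof -
  obtain q where q: "r < of_rat q" "of_rat q < s"
    using of_rat_dense \<open>r < s\<close> by blast
  obtain i k where ik: "q = Fract i k" "k > 0"
    by (metis Rat_cases)
  have "of_rat q = frac_val (nat i) (nat (- i)) (nat (k - 1))"
    using ik by (simp add: of_rat_rat)
  then show ?thesis using q by metis
qed

context submodel
begin

lemma H_vset:
  assumes "X \<subseteq> H" "X \<prec> elts \<theta>" shows "vset X \<in> H" "elts (vset X) = X"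
proof -
  show e: "elts (vset X) = X"
    using is_set_lepoll[OF lesspoll_imp_lepoll[OF assms(2)] is_set_elts] by (rule elts_vset)
  show "vset X \<in> H" by (rule Hset_I[OF reg]) (simp_all add: e assms)
qed

lemma countable_less: "countable X \<Longrightarrow> X \<prec> elts \<theta>"
proof -
  assume "countable X"
  then have "X \<lesssim> (UNIV :: nat set)" by (auto simp: countable_def lepoll_def)
  also have "(UNIV :: nat set) \<lesssim> range (vreal :: real \<Rightarrow> 'v)"
    unfolding lepoll_def
    by (intro exI[of _ "\<lambda>n. vreal (real n)"]) (auto simp: inj_on_def vreal_inject)
  also have "\<dots> \<prec> elts \<theta>" by (rule big)
  finally show ?thesis .
qed

lemma H_countable:
  assumes "X \<subseteq> H" "countable X" shows "vset X \<in> H" "elts (vset X) = X"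
  using H_vset[OF assms(1) countable_less[OF assms(2)]] by auto

lemma vpair_H: "x \<in> H \<Longrightarrow> y \<in> H \<Longrightarrow> vpair x y \<in> H"
  unfolding vpair_def by (intro H_countable) (auto intro!: H_countable)

lemma vnat_H: "vnat n \<in> H"
proof (induction n rule: less_induct)
  case (less n)
  then have "vset (vnat ` {..<n}) \<in> H" by (intro H_countable) auto
  then show ?case by (metis elts_vnat vset_def extensionality elts_vset is_set_elts)
qed

lemma vreal_H: "vreal r \<in> H"
proof (rule Hset_I[OF reg])
  show "elts (vreal r) \<subseteq> H" by (auto simp: elts_vreal intro!: vpair_H vnat_H)
  have "elts (vreal r) \<subseteq> range (\<lambda>(a, b, c). vfrac a b c)"
    by (force simp: elts_vreal intro: range_eqI[of _ _ "(a, b, c)" for a b c])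
  then show "elts (vreal r) \<prec> elts \<theta>"
    by (intro countable_less) (rule countable_subset[OF _ countable_image[OF countableI_type]])
qed

lemma is_term_H: "is_term M x \<Longrightarrow> range s \<subseteq> H \<Longrightarrow> x s \<in> H"
  using M_H by (auto elim!: is_termE)

text \<open>These rules take precedence over \<open>definability\<close>, whose rules for atomic formulas would match
  the same goals and leave unprovable premises.\<close>

named_theorems compound

lemma dfn_empty [compound]: "is_term M x \<Longrightarrow> dfn (\<lambda>s. elts (x s) = {})"
  by (rule definable_cong[of _ _ "\<lambda>s. \<forall>a\<in>elts (x s). False"])
    (intro definability; assumption | blast)+

lemma dfn_vsucc [compound]:
  assumes "is_term M m" "is_term M n" shows "dfn (\<lambda>s. m s = vsucc (n s))"
  unfolding eq_vsucc_iff using assms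
  by (elim is_termE; hypsubst) (rule definability | assumption)+

lemma dfn_upair [compound]:
  assumes "is_term M w" "is_term M x" "is_term M y" shows "dfn (\<lambda>s. w s = vset {x s, y s})"
  unfolding eq_upair_iff using assms
  by (elim is_termE; hypsubst) (rule definability | assumption)+

lemma dfn_vpair [compound]:
  assumes "is_term M p" "is_term M x" "is_term M y" shows "dfn (\<lambda>s. p s = vpair (x s) (y s))"
  unfolding eq_vpair_iff using assms
  by (elim is_termE; hypsubst) (rule compound | rule definability | assumption)+

lemma dfn_vpair_mem [compound]:
  assumes "is_term M g" "is_term M x" "is_term M y" shows "dfn (\<lambda>s. vpair (x s) (y s) \<in> elts (g s))"
proof (rule definable_cong)
  show "dfn (\<lambda>s. \<exists>p\<in>elts (g s). p = vpair (x s) (y s))"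
    using assms by (elim is_termE; hypsubst) (rule compound | rule definability | assumption)+
qed blast

lemma dfn_vtriple [compound]:
  assumes "is_term M p" "is_term M a" "is_term M b" "is_term M c"
  shows "dfn (\<lambda>s. p s = vtriple (a s) (b s) (c s))"
proof (rule definable_cong)
  show "dfn (\<lambda>s. \<exists>q\<in>H. q = vpair (b s) (c s) \<and> p s = vpair (a s) q)"
    using assms by (elim is_termE; hypsubst) (rule compound | rule definability | assumption)+
qed (use assms is_term_H in \<open>auto intro: vpair_H\<close>)

lemma dfn_vtriple_mem [compound]:
  assumes "is_term M g" "is_term M a" "is_term M b" "is_term M c"
  shows "dfn (\<lambda>s. vtriple (a s) (b s) (c s) \<in> elts (g s))"
proof (rule definable_cong)
  show "dfn (\<lambda>s. \<exists>q\<in>H. q = vpair (b s) (c s) \<and> vpair (a s) q \<in> elts (g s))"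
    using assms by (elim is_termE; hypsubst) (rule compound | rule definability | assumption)+
qed (use assms is_term_H in \<open>auto intro: vpair_H\<close>)

definition omega :: 'v where "omega = vset (range vnat)"

lemma elts_omega: "elts omega = range vnat" and omega_H: "omega \<in> H"
  unfolding omega_def by (rule H_countable; auto simp: vnat_H)+

lemma vnat_0_M: "vnat 0 \<in> M"
proof (rule unique_in_M)
  show "dfn (\<lambda>s. elts (s 0) = {})" by (rule compound definability)+
  show "b = vnat 0" if "elts b = {}" for b
    by (rule extensionality) (simp only: that elts_vnat_0)
qed (simp_all add: vnat_H elts_vnat_0)

text \<open>By foundation the last clause of \<open>?P\<close> excludes further elements: descending
  through predecessors must end at the empty set.\<close>

lemma omega_M: "omega \<in> M"
proof (rule unique_in_M)
  let ?P = "\<lambda>w. (\<exists>e\<in>elts w. elts e = {}) \<and> (\<forall>n\<in>elts w. \<exists>m\<in>elts w. m = vsucc n) \<and>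
    (\<forall>n\<in>elts w. elts n = {} \<or> (\<exists>m\<in>elts w. n = vsucc m))"
  show "dfn (\<lambda>s. ?P (s 0))" by (rule compound | rule definability)+
  have zero: "e = vnat 0" if "elts e = {}" for e :: 'v
    by (rule extensionality) (simp only: that elts_vnat_0)
  show "?P omega"
  proof (intro conjI ballI)
    show "\<exists>e\<in>elts omega. elts e = {}" unfolding elts_omega using elts_vnat_0 by blast
    show "\<exists>m\<in>elts omega. m = vsucc n" if "n \<in> elts omega" for n
      using that unfolding elts_omega by (metis vnat_Suc rangeE rangeI)
    show "elts n = {} \<or> (\<exists>m\<in>elts omega. n = vsucc m)" if "n \<in> elts omega" for n
    proof -
      obtain k where k: "n = vnat k" using \<open>n \<in> elts omega\<close> unfolding elts_omega by blast
      show ?thesis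
      proof (cases k)
        case 0
        then show ?thesis using k elts_vnat_0 by blast
      next
        case (Suc j)
        then show ?thesis using k vnat_Suc[of j] unfolding elts_omega by blast
      qed
    qed
  qed
  fix w :: 'v assume w: "?P w"
  have "vnat n \<in> elts w" for n
  proof (induction n)
    case 0
    then show ?case using w zero by metis
  next
    case (Suc n)
    then show ?case using w vnat_Suc by metis
  qed
  moreover have "n \<in> elts w \<Longrightarrow> n \<in> range vnat" for n
  proof (induction n rule: mem_induct)
    case (mem n)
    show ?case
    proof (cases "elts n = {}")
      case True
      then show ?thesis using zero by blast
    next
      case False
      then obtain m where m: "m \<in> elts w" "n = vsucc m" using w mem.prems by blast
      then have "m \<in> range vnat" by (intro mem.IH) (simp_all add: elts_vsucc)
      then show ?thesis using m(2) vnat_Suc by (metis rangeE rangeI)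
    qed
  qed
  ultimately show "w = omega" by (intro extensionality) (auto simp: elts_omega)
qed (rule omega_H)

text \<open>\<open>P\<close> fixes \<open>A\<close> only on triples of numbers, so \<open>A\<close>
  is not unique; elementarity still yields some such \<open>A\<close> in \<open>M\<close>, which
  serves as a parameter.\<close>

lemma recursion_in_M:
  fixes h :: "nat \<Rightarrow> nat \<Rightarrow> nat"
  assumes dfn: "dfn (\<lambda>s. P (s 0))" and P: "\<And>A. P A \<longleftrightarrow> (\<forall>a b c. vfrac a b c \<in> elts A \<longleftrightarrow> c = h a b)"
  shows "\<exists>A\<in>M. \<forall>a b c. vfrac a b c \<in> elts A \<longleftrightarrow> c = h a b"
proof -
  let ?X = "range (\<lambda>(a, b). vfrac a b (h a b)) :: 'v set"
  have X: "?X \<subseteq> H" "countable ?X" by (auto intro!: vpair_H vnat_H)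
  have "P (vset ?X)"
    unfolding P H_countable(2)[OF X] by (auto simp: vpair_inject vnat_inject)
  then show ?thesis using witness_in_M[OF dfn H_countable(1)[OF X]] unfolding P by blast
qed

lemma omega_ball: "(\<forall>a\<in>elts omega. Q a) \<longleftrightarrow> (\<forall>n. Q (vnat n))"
  and omega_bex: "(\<exists>a\<in>elts omega. Q a) \<longleftrightarrow> (\<exists>n. Q (vnat n))"
  by (auto simp: elts_omega)

lemma vnat_eq_vsucc: "vnat m = vsucc (vnat n) \<longleftrightarrow> m = Suc n"
  by (metis vnat_Suc vnat_inject)

lemma add_in_M: "\<exists>A\<in>M. \<forall>a b c. vfrac a b c \<in> elts A \<longleftrightarrow> c = a + b"
proof (rule recursion_in_M)
  let ?P = "\<lambda>A. \<forall>a\<in>elts omega. \<forall>c\<in>elts omega. (vtriple a (vnat 0) c \<in> elts A \<longleftrightarrow> c = a) \<and>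
    (\<forall>b\<in>elts omega. \<forall>b'\<in>elts omega. b' = vsucc b \<longrightarrow>
      (vtriple a b' c \<in> elts A \<longleftrightarrow> (\<exists>d\<in>elts omega. c = vsucc d \<and> vtriple a b d \<in> elts A)))"
  show "dfn (\<lambda>s. ?P (s 0))" by (rule compound | rule definability | rule omega_M vnat_0_M)+
  show "?P A \<longleftrightarrow> (\<forall>a b c. vfrac a b c \<in> elts A \<longleftrightarrow> c = a + b)" (is "_ \<longleftrightarrow> ?Q") for A
  proof
    assume P: "?P A"
    have "vfrac a b c \<in> elts A \<longleftrightarrow> c = a + b" for a b c
    proof (induction b arbitrary: c)
      case 0
      then show ?case using P unfolding omega_ball vnat_inject by simp
    next
      case (Suc b)
      then have "vfrac a (Suc b) c \<in> elts A \<longleftrightarrow> (\<exists>d. vnat c = vsucc (vnat d) \<and> d = a + b)"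
        using P unfolding omega_ball omega_bex vnat_eq_vsucc by blast
      then show ?case by (simp add: vnat_eq_vsucc)
    qed
    then show ?Q by blast
  next
    assume ?Q
    then show "?P A" unfolding omega_ball omega_bex vnat_eq_vsucc vnat_inject by simp
  qed
qed

lemma mult_in_M: "\<exists>A\<in>M. \<forall>a b c. vfrac a b c \<in> elts A \<longleftrightarrow> c = a * b"
proof -
  obtain D where D: "D \<in> M" "\<And>a b c. vfrac a b c \<in> elts D \<longleftrightarrow> c = a + b"
    using add_in_M by blast
  let ?P = "\<lambda>A. \<forall>a\<in>elts omega. \<forall>c\<in>elts omega. (vtriple a (vnat 0) c \<in> elts A \<longleftrightarrow> c = vnat 0) \<and>
    (\<forall>b\<in>elts omega. \<forall>b'\<in>elts omega. b' = vsucc b \<longrightarrow>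
      (vtriple a b' c \<in> elts A \<longleftrightarrow> (\<exists>d\<in>elts omega. vtriple a b d \<in> elts A \<and> vtriple d a c \<in> elts D)))"
  show ?thesis
  proof (rule recursion_in_M)
    show "dfn (\<lambda>s. ?P (s 0))" by (rule compound | rule definability | rule omega_M vnat_0_M D(1))+
    show "?P A \<longleftrightarrow> (\<forall>a b c. vfrac a b c \<in> elts A \<longleftrightarrow> c = a * b)" (is "_ \<longleftrightarrow> ?Q") for A
    proof
      assume P: "?P A"
      have "vfrac a b c \<in> elts A \<longleftrightarrow> c = a * b" for a b c
      proof (induction b arbitrary: c)
        case 0
        then show ?case using P unfolding omega_ball vnat_inject by simp
      next
        case (Suc b)
        then have "vfrac a (Suc b) c \<in> elts A \<longleftrightarrow> (\<exists>d. d = a * b \<and> vfrac d a c \<in> elts D)"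
          using P unfolding omega_ball omega_bex vnat_eq_vsucc by blast
        then show ?case by (simp add: D(2) add.commute)
      qed
      then show ?Q by blast
    next
      assume ?Q
      then show "?P A" unfolding omega_ball omega_bex vnat_eq_vsucc vnat_inject D(2) by (simp add: add.commute)
    qed
  qed
qed

definition fractions :: 'v where
  "fractions = vset (range (\<lambda>(a, b, c). vfrac a b c))"

lemma elts_fractions: "elts fractions = range (\<lambda>(a, b, c). vfrac a b c)"
  and fractions_H: "fractions \<in> H"
  unfolding fractions_def by (rule H_countable; auto intro!: vpair_H vnat_H)+

lemma vfrac_fractions: "vfrac a b c \<in> elts fractions"
  unfolding elts_fractions by (rule range_eqI[of _ _ "(a, b, c)"]) simp

lemma fractionsE:
  assumes "p \<in> elts fractions" obtains a b c where "p = vfrac a b c"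
  using assms unfolding elts_fractions by auto

lemma fractions_M: "fractions \<in> M"
proof (rule unique_in_M)
  let ?P = "\<lambda>q. (\<forall>p\<in>elts q. \<exists>a\<in>elts omega. \<exists>b\<in>elts omega. \<exists>c\<in>elts omega. p = vtriple a b c) \<and>
    (\<forall>a\<in>elts omega. \<forall>b\<in>elts omega. \<forall>c\<in>elts omega. vtriple a b c \<in> elts q)"
  show "dfn (\<lambda>s. ?P (s 0))" by (rule compound | rule definability | rule omega_M)+
  show "?P fractions" using vfrac_fractions by (auto simp: omega_ball omega_bex elim!: fractionsE)
  show "q = fractions" if "?P q" for q
    using that by (intro extensionality) (auto simp: omega_ball omega_bex elim!: fractionsE intro: vfrac_fractions)
qed (rule fractions_H)

lemma order_in_M:
  "\<exists>L\<in>M. \<forall>a b c a' b' c'. vpair (vfrac a b c) (vfrac a' b' c') \<in> elts L \<longleftrightarrow>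
     frac_val a b c < frac_val a' b' c'"
proof -
  obtain D where D: "D \<in> M" "\<And>a b c. vfrac a b c \<in> elts D \<longleftrightarrow> c = a + b"
    using add_in_M by blast
  obtain E where E: "E \<in> M" "\<And>a b c. vfrac a b c \<in> elts E \<longleftrightarrow> c = a * b"
    using mult_in_M by blast
  let ?W = "elts omega"
  let ?less = "\<lambda>a b c a' b' c'. \<exists>d\<in>?W. \<exists>d'\<in>?W. d = vsucc c \<and> d' = vsucc c' \<and>
    (\<exists>x1\<in>?W. \<exists>x2\<in>?W. \<exists>x3\<in>?W. \<exists>x4\<in>?W. \<exists>y1\<in>?W. \<exists>y2\<in>?W.
      vtriple a d' x1 \<in> elts E \<and> vtriple b' d x2 \<in> elts E \<and>
      vtriple a' d x3 \<in> elts E \<and> vtriple b d' x4 \<in> elts E \<and>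
      vtriple x1 x2 y1 \<in> elts D \<and> vtriple x3 x4 y2 \<in> elts D \<and> y1 \<in> elts y2)"
  have less: "?less (vnat a) (vnat b) (vnat c) (vnat a') (vnat b') (vnat c') \<longleftrightarrow>
      frac_val a b c < frac_val a' b' c'" for a b c a' b' c'
    unfolding frac_val_less_iff omega_bex vnat_eq_vsucc D(2) E(2) vnat_mem_iff by blast
  \<comment> \<open>The triples are bound as \<open>p\<close> and \<open>p'\<close> because the
    definability rules accept only variables and constants as components of a pair that is tested
    for membership in \<open>L\<close>.\<close>
  let ?P = "\<lambda>L. \<forall>a\<in>?W. \<forall>b\<in>?W. \<forall>c\<in>?W. \<forall>a'\<in>?W. \<forall>b'\<in>?W. \<forall>c'\<in>?W.
    \<forall>p\<in>H. p = vtriple a b c \<longrightarrow> (\<forall>p'\<in>H. p' = vtriple a' b' c' \<longrightarrow>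
      (vpair p p' \<in> elts L \<longleftrightarrow> ?less a b c a' b' c'))"
  have P: "?P L \<longleftrightarrow> (\<forall>a b c a' b' c'. vpair (vfrac a b c) (vfrac a' b' c') \<in> elts L \<longleftrightarrow>
     frac_val a b c < frac_val a' b' c')" for L
  proof -
    have one: "(\<forall>p\<in>H. p = vfrac a b c \<longrightarrow> Q p) \<longleftrightarrow> Q (vfrac a b c)" for a b c Q
      using vpair_H[OF vnat_H vpair_H[OF vnat_H vnat_H]] by blast
    show ?thesis by (simp only: omega_ball less one)
  qed
  have dfn: "dfn (\<lambda>s. ?P (s 0))"
    by (rule compound | rule definability | rule omega_M D(1) E(1))+
  let ?g = "\<lambda>(a, b, c, a', b', c'). vpair (vfrac a b c) (vfrac a' b' c') :: 'v"
  let ?X = "?g ` {(a, b, c, a', b', c'). frac_val a b c < frac_val a' b' c'}"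
  have X: "?X \<subseteq> H" "countable ?X" by (auto intro!: vpair_H vnat_H)
  have "?P (vset ?X)"
    by (rule iffD2[OF P], unfold H_countable(2)[OF X]) (auto simp: vpair_inject vnat_inject image_iff)
  then show ?thesis using witness_in_M[OF dfn H_countable(1)[OF X]] unfolding P by blast
qed

end

section \<open>Continuity and Corson families expressed over the submodel\<close>

section \<open>Separating families in the submodel\<close>

lemma vfrac_mem_vreal: "vfrac a b c \<in> elts (vreal r) \<longleftrightarrow> frac_val a b c < r"
  by (auto simp: elts_vreal vpair_inject vnat_inject)

lemma base_open:
  assumes "openin T = arbitrary union_of (\<lambda>U. U \<in> elts ` elts B)" "U \<in> elts B"
  shows "openin T (elts U)"
  unfolding assms(1) by (rule arbitrary_union_of_inc) (use assms(2) in blast)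

lemma base_neighbourhood:
  assumes "openin T = arbitrary union_of (\<lambda>U. U \<in> elts ` elts B)" "openin T W" "x \<in> W"
  shows "\<exists>U\<in>elts B. x \<in> elts U \<and> elts U \<subseteq> W"
  using assms(2,3) unfolding assms(1) union_of_def arbitrary_def by blast

context submodel
begin

definition is_cut :: "'v \<Rightarrow> 'v \<Rightarrow> bool" where
  "is_cut L u \<longleftrightarrow> (\<forall>p\<in>elts u. p \<in> elts fractions) \<and> (\<exists>p\<in>elts fractions. p \<in> elts u) \<and>
     (\<exists>p\<in>elts fractions. p \<notin> elts u) \<and> (\<forall>p\<in>elts u. \<exists>q\<in>elts u. vpair p q \<in> elts L) \<and>
     (\<forall>p\<in>elts u. \<forall>q\<in>elts fractions. vpair q p \<in> elts L \<longrightarrow> q \<in> elts u)"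

definition is_order :: "'v \<Rightarrow> bool" where
  "is_order L \<longleftrightarrow> (\<forall>a b c a' b' c'. vpair (vfrac a b c) (vfrac a' b' c') \<in> elts L \<longleftrightarrow>
     frac_val a b c < frac_val a' b' c')"

lemma fractions_ball: "(\<forall>p\<in>elts fractions. P p) \<longleftrightarrow> (\<forall>a b c. P (vfrac a b c))"
  and fractions_bex: "(\<exists>p\<in>elts fractions. P p) \<longleftrightarrow> (\<exists>a b c. P (vfrac a b c))"
  unfolding elts_fractions by auto

lemma vreal_ball: "(\<forall>p\<in>elts (vreal r). P p) \<longleftrightarrow> (\<forall>a b c. frac_val a b c < r \<longrightarrow> P (vfrac a b c))"
  and vreal_bex: "(\<exists>p\<in>elts (vreal r). P p) \<longleftrightarrow> (\<exists>a b c. frac_val a b c < r \<and> P (vfrac a b c))"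
  unfolding elts_vreal by blast+

text \<open>The real is the supremum of the values in \<open>u\<close>. Having no largest element
  makes the inequality strict, and with downward closure it also brings in every triple representing
  the same fraction.\<close>

lemma is_cut_iff:
  assumes L: "is_order L" shows "is_cut L u \<longleftrightarrow> (\<exists>r. u = vreal r)"
proof
  have L: "vpair (vfrac a b c) (vfrac a' b' c') \<in> elts L \<longleftrightarrow>
     frac_val a b c < frac_val a' b' c'" for a b c a' b' c'
    using L by (simp add: is_order_def)
  {
    assume "\<exists>r. u = vreal r"
    then obtain r where r: "u = vreal r" by blast
    show "is_cut L u"
      unfolding is_cut_def r vreal_ball vreal_bex fractions_ball fractions_bex L vfrac_mem_vreal
    proof (intro conjI allI impI)
      show "vfrac a b c \<in> elts fractions" for a b c by (rule vfrac_fractions)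
      show "\<exists>a b c. frac_val a b c < r" using frac_val_dense[of "r - 1" r] by auto
      show "\<exists>a b c. \<not> frac_val a b c < r" using frac_val_dense[of r "r + 1"] by (auto simp: not_less intro: less_imp_le)
      show "\<exists>a' b' c'. frac_val a' b' c' < r \<and> frac_val a b c < frac_val a' b' c'"
        if "frac_val a b c < r" for a b c
        using frac_val_dense[OF that] by blast
    qed (rule less_trans)
  next
    assume cut: "is_cut L u"
    then have sub: "\<exists>a b c. p = vfrac a b c" if "p \<in> elts u" for p
      using that unfolding is_cut_def by (blast elim: fractionsE)
    from cut have ne: "\<exists>a b c. vfrac a b c \<in> elts u" and proper: "\<exists>a b c. vfrac a b c \<notin> elts u"
      and up: "\<And>p. p \<in> elts u \<Longrightarrow> \<exists>q\<in>elts u. vpair p q \<in> elts L"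
      and down: "\<And>p a b c. p \<in> elts u \<Longrightarrow> vpair (vfrac a b c) p \<in> elts L \<Longrightarrow> vfrac a b c \<in> elts u"
      unfolding is_cut_def fractions_ball fractions_bex by blast+
    define S where "S = {frac_val a b c | a b c. vfrac a b c \<in> elts u}"
    obtain a0 b0 c0 where out: "vfrac a0 b0 c0 \<notin> elts u" using proper by blast
    have bd: "bdd_above S"
    proof (rule bdd_aboveI[of _ "frac_val a0 b0 c0"])
      fix t assume "t \<in> S"
      then obtain a b c where t: "t = frac_val a b c" "vfrac a b c \<in> elts u" by (auto simp: S_def)
      show "t \<le> frac_val a0 b0 c0"
        using down[OF t(2), of a0 b0 c0] out unfolding L t(1) by linarith
    qed
    have Sne: "S \<noteq> {}" using ne by (auto simp: S_def)
    have "vfrac a b c \<in> elts u \<longleftrightarrow> frac_val a b c < Sup S" for a b c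
    proof
      assume "vfrac a b c \<in> elts u"
      then obtain q where q: "q \<in> elts u" "vpair (vfrac a b c) q \<in> elts L" using up by blast
      then obtain a' b' c' where q': "q = vfrac a' b' c'" using sub by blast
      then have "frac_val a' b' c' \<in> S" using q(1) by (auto simp: S_def)
      then have "frac_val a' b' c' \<le> Sup S" using bd by (rule cSup_upper)
      then show "frac_val a b c < Sup S" using q(2) unfolding q' L by linarith
    next
      assume "frac_val a b c < Sup S"
      then obtain t where "t \<in> S" "frac_val a b c < t"
        using less_cSup_iff[OF Sne bd] by blast
      then show "vfrac a b c \<in> elts u" using down L by (auto simp: S_def)
    qed
    then have "elts u = elts (vreal (Sup S))"
      using sub unfolding elts_vreal by blast
    then show "\<exists>r. u = vreal r" using extensionality by blast
  }
qed

text \<open>The last two clauses are lower and upper semicontinuity, tested on the base. For a cut,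
  \<open>p \<notin> elts u\<close> only means that the value is at most \<open>p\<close>; upper
  semicontinuity therefore passes to a larger fraction \<open>q\<close>.\<close>

definition cont_graph :: "'v \<Rightarrow> 'v \<Rightarrow> 'v \<Rightarrow> 'v \<Rightarrow> bool" where
  "cont_graph L B K g \<longleftrightarrow>
     (\<forall>p\<in>elts g. \<exists>x\<in>elts K. \<exists>u\<in>H. p = vpair x u \<and> is_cut L u) \<and>
     (\<forall>x\<in>elts K. \<exists>u\<in>H. vpair x u \<in> elts g) \<and>
     (\<forall>x\<in>elts K. \<forall>u\<in>H. \<forall>v\<in>H. vpair x u \<in> elts g \<longrightarrow> vpair x v \<in> elts g \<longrightarrow> u = v) \<and>
     (\<forall>x\<in>elts K. \<forall>u\<in>H. vpair x u \<in> elts g \<longrightarrow> (\<forall>p\<in>elts u. \<exists>U\<in>elts B. x \<in> elts U \<and>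
        (\<forall>y\<in>elts U. \<forall>v\<in>H. vpair y v \<in> elts g \<longrightarrow> p \<in> elts v))) \<and>
     (\<forall>x\<in>elts K. \<forall>u\<in>H. vpair x u \<in> elts g \<longrightarrow> (\<forall>p\<in>elts fractions. p \<notin> elts u \<longrightarrow>
        (\<forall>q\<in>elts fractions. vpair p q \<in> elts L \<longrightarrow> (\<exists>U\<in>elts B. x \<in> elts U \<and>
          (\<forall>y\<in>elts U. \<forall>v\<in>H. vpair y v \<in> elts g \<longrightarrow> q \<notin> elts v)))))"

lemma dfn_cont_graph [compound]:
  assumes "is_term M g" "L \<in> M" "B \<in> M" "K \<in> M"
  shows "dfn (\<lambda>s. cont_graph L B K (g s))"
  unfolding cont_graph_def is_cut_def using assms
  by (elim is_termE; hypsubst) (rule compound | rule definability | rule fractions_M | assumption)+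

lemma vgraph_H:
  assumes "K \<in> H" shows "vgraph K f \<in> H"
proof (rule Hset_I[OF reg])
  show "elts (vgraph K f) \<subseteq> H"
    using Hset_mem[OF assms] by (auto simp: elts_vgraph intro!: vpair_H vreal_H)
  have "elts (vgraph K f) = (\<lambda>x. vpair x (vreal (f x))) ` elts K" by (auto simp: elts_vgraph)
  then show "elts (vgraph K f) \<prec> elts \<theta>"
    using lesspoll_trans1[OF image_lepoll elts_lesspoll[OF assms]] by simp
qed

lemma cont_graph_vgraph:
  assumes L: "is_order L" and K: "topspace T = elts K"
    and B: "openin T = arbitrary union_of (\<lambda>U. U \<in> elts ` elts B)"
    and f: "continuous_map T euclideanreal f"
  shows "cont_graph L B K (vgraph K f)"
proof -
  have L': "vpair (vfrac a b c) (vfrac a' b' c') \<in> elts L \<longleftrightarrow>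
     frac_val a b c < frac_val a' b' c'" for a b c a' b' c'
    using L by (simp add: is_order_def)
  have sl: "openin T {x \<in> topspace T. f x < t}" "openin T {x \<in> topspace T. t < f x}" for t
    using f unfolding continuous_map_upper_lower_semicontinuous_lt by auto
  have UK: "y \<in> elts K" if "U \<in> elts B" "y \<in> elts U" for U y
    using openin_subset[OF base_open[OF B that(1)]] that(2) K by auto
  show ?thesis unfolding cont_graph_def
  proof (intro conjI ballI impI)
    fix p assume "p \<in> elts (vgraph K f)"
    then show "\<exists>x\<in>elts K. \<exists>u\<in>H. p = vpair x u \<and> is_cut L u"
      unfolding elts_vgraph is_cut_iff[OF L] using vreal_H by blast
  next
    show "\<exists>u\<in>H. vpair x u \<in> elts (vgraph K f)" if "x \<in> elts K" for x
      unfolding vpair_mem_vgraph using that vreal_H by blast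
  next
    show "u = v" if "vpair x u \<in> elts (vgraph K f)" "vpair x v \<in> elts (vgraph K f)" for x u v
      using that unfolding vpair_mem_vgraph by simp
  next
    fix x u p assume x: "x \<in> elts K" "vpair x u \<in> elts (vgraph K f)" and p: "p \<in> elts u"
    then obtain a b c where p': "p = vfrac a b c" "frac_val a b c < f x"
      unfolding vpair_mem_vgraph by (auto simp: elts_vreal)
    then obtain U where "U \<in> elts B" "x \<in> elts U" "elts U \<subseteq> {y \<in> topspace T. frac_val a b c < f y}"
      using base_neighbourhood[OF B sl(2), of x "frac_val a b c"] x(1) K by auto
    then show "\<exists>U\<in>elts B. x \<in> elts U \<and> (\<forall>y\<in>elts U. \<forall>v\<in>H. vpair y v \<in> elts (vgraph K f) \<longrightarrow> p \<in> elts v)"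
      unfolding vpair_mem_vgraph p'(1) by (auto simp: vfrac_mem_vreal intro!: bexI[of _ U])
  next
    fix x u p q assume x: "x \<in> elts K" "vpair x u \<in> elts (vgraph K f)" and "p \<in> elts fractions"
      "p \<notin> elts u" "q \<in> elts fractions" "vpair p q \<in> elts L"
    then obtain a b c where q: "q = vfrac a b c" "f x < frac_val a b c"
      unfolding vpair_mem_vgraph by (elim fractionsE) (auto simp: L' vfrac_mem_vreal not_less)
    then obtain U where "U \<in> elts B" "x \<in> elts U" "elts U \<subseteq> {y \<in> topspace T. f y < frac_val a b c}"
      using base_neighbourhood[OF B sl(1), of x "frac_val a b c"] x(1) K by auto
    then show "\<exists>U\<in>elts B. x \<in> elts U \<and> (\<forall>y\<in>elts U. \<forall>v\<in>H. vpair y v \<in> elts (vgraph K f) \<longrightarrow> q \<notin> elts v)"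
      unfolding vpair_mem_vgraph q(1) by (intro bexI[of _ U]) (auto simp: vfrac_mem_vreal not_less intro: less_imp_le)
  qed
qed

lemma cont_graphD:
  assumes L: "is_order L" and K: "topspace T = elts K"
    and B: "openin T = arbitrary union_of (\<lambda>U. U \<in> elts ` elts B)"
    and g: "cont_graph L B K g"
  shows "\<exists>f. continuous_map T euclideanreal f \<and> g = vgraph K f"
proof -
  have L': "vpair (vfrac a b c) (vfrac a' b' c') \<in> elts L \<longleftrightarrow>
     frac_val a b c < frac_val a' b' c'" for a b c a' b' c'
    using L by (simp add: is_order_def)
  note c = g[unfolded cont_graph_def]
  note g1 = c[THEN conjunct1, rule_format]
    and g2 = c[THEN conjunct2, THEN conjunct1, rule_format]
    and g3 = c[THEN conjunct2, THEN conjunct2, THEN conjunct1, rule_format]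
    and g4 = c[THEN conjunct2, THEN conjunct2, THEN conjunct2, THEN conjunct1, rule_format]
    and g5 = c[THEN conjunct2, THEN conjunct2, THEN conjunct2, THEN conjunct2, rule_format]
  have "\<exists>r. vpair x (vreal r) \<in> elts g" if x: "x \<in> elts K" for x
  proof -
    obtain u where u: "u \<in> H" "vpair x u \<in> elts g" using g2[OF x] by blast
    then obtain y v where "vpair x u = vpair y v" "is_cut L v" using g1 by blast
    then show ?thesis using u(2) unfolding is_cut_iff[OF L] by (auto simp: vpair_inject)
  qed
  then obtain f where f: "\<And>x. x \<in> elts K \<Longrightarrow> vpair x (vreal (f x)) \<in> elts g" by metis
  have mem: "vpair x u \<in> elts g \<longleftrightarrow> x \<in> elts K \<and> u = vreal (f x)" for x u
  proof
    assume xu: "vpair x u \<in> elts g"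
    then obtain y v where "y \<in> elts K" "v \<in> H" "vpair x u = vpair y v" using g1 by blast
    then have "x \<in> elts K" "u \<in> H" by (auto simp: vpair_inject)
    then show "x \<in> elts K \<and> u = vreal (f x)" using g3[OF _ _ vreal_H xu f] by blast
  qed (use f in blast)
  have "elts g = elts (vgraph K f)"
  proof (intro equalityI subsetI)
    fix p assume "p \<in> elts g"
    then show "p \<in> elts (vgraph K f)" using g1[of p] mem by (auto simp: elts_vgraph)
  qed (auto simp: elts_vgraph mem)
  then have gv: "g = vgraph K f" by (rule extensionality)
  have UK: "y \<in> elts K" if "U \<in> elts B" "y \<in> elts U" for U y
    using openin_subset[OF base_open[OF B that(1)]] that(2) K by auto
  have "openin T {x \<in> topspace T. t < f x}" for t
  proof (subst openin_subopen, intro ballI)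
    fix x assume "x \<in> {x \<in> topspace T. t < f x}"
    then have x: "x \<in> elts K" "t < f x" by (auto simp: K)
    obtain a b c where q: "t < frac_val a b c" "frac_val a b c < f x" using frac_val_dense[OF x(2)] by blast
    then obtain U where U: "U \<in> elts B" "x \<in> elts U"
      "\<forall>y\<in>elts U. \<forall>v\<in>H. vpair y v \<in> elts g \<longrightarrow> vfrac a b c \<in> elts v"
      using g4[OF x(1) vreal_H f[OF x(1)], of "vfrac a b c"] by (auto simp: vfrac_mem_vreal)
    have "frac_val a b c < f y" if "y \<in> elts U" for y
    proof -
      have "vfrac a b c \<in> elts (vreal (f y) :: 'v)"
        using U(3) that f[OF UK[OF U(1) that]] vreal_H[of "f y"] by blast
      then show ?thesis by (simp only: vfrac_mem_vreal)
    qed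
    then have "elts U \<subseteq> {x \<in> topspace T. t < f x}" using UK[OF U(1)] q(1) K by force
    then show "\<exists>W. openin T W \<and> x \<in> W \<and> W \<subseteq> {x \<in> topspace T. t < f x}"
      using base_open[OF B U(1)] U(2) by blast
  qed
  moreover have "openin T {x \<in> topspace T. f x < t}" for t
  proof (subst openin_subopen, intro ballI)
    fix x assume "x \<in> {x \<in> topspace T. f x < t}"
    then have x: "x \<in> elts K" "f x < t" by (auto simp: K)
    \<comment> \<open>Two fractions below \<open>t\<close> are needed: the first bounds the value at
      \<open>x\<close>, the larger one bounds the values on the neighbourhood.\<close>
    obtain a b c where p: "f x < frac_val a b c" "frac_val a b c < t" using frac_val_dense[OF x(2)] by blast
    obtain a' b' c' where q: "frac_val a b c < frac_val a' b' c'" "frac_val a' b' c' < t"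
      using frac_val_dense[OF p(2)] by blast
    have "vfrac a b c \<notin> elts (vreal (f x))" using p(1) by (simp add: vfrac_mem_vreal)
    then obtain U where U: "U \<in> elts B" "x \<in> elts U"
      "\<forall>y\<in>elts U. \<forall>v\<in>H. vpair y v \<in> elts g \<longrightarrow> vfrac a' b' c' \<notin> elts v"
      using g5[OF x(1) vreal_H f[OF x(1)] vfrac_fractions _ vfrac_fractions] q(1) L' by blast
    have "f y \<le> frac_val a' b' c'" if "y \<in> elts U" for y
    proof -
      have "vfrac a' b' c' \<notin> elts (vreal (f y) :: 'v)"
        using U(3) that f[OF UK[OF U(1) that]] vreal_H[of "f y"] by blast
      then show ?thesis by (simp only: vfrac_mem_vreal not_less)
    qed
    then have "elts U \<subseteq> {x \<in> topspace T. f x < t}" using UK[OF U(1)] q(2) K by force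
    then show "\<exists>W. openin T W \<and> x \<in> W \<and> W \<subseteq> {x \<in> topspace T. f x < t}"
      using base_open[OF B U(1)] U(2) by blast
  qed
  ultimately have "continuous_map T euclideanreal f"
    unfolding continuous_map_upper_lower_semicontinuous_lt by blast
  then show ?thesis using gv by blast
qed

text \<open>The clause on \<open>h\<close> says that fewer than \<open>\<kappa>\<close> members of \<open>F\<close> differ from \<open>z\<close> at \<open>x\<close>:
  they are enumerated by an ordinal below \<open>\<kappa>\<close>.\<close>

definition corson_family :: "'v \<Rightarrow> 'v \<Rightarrow> 'v \<Rightarrow> 'v \<Rightarrow> 'v \<Rightarrow> 'v \<Rightarrow> bool" where
  "corson_family L B K \<kappa> F z \<longleftrightarrow> (\<forall>g\<in>elts F. cont_graph L B K g) \<and>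
     (\<forall>x\<in>elts K. \<forall>y\<in>elts K. x = y \<or>
        (\<exists>g\<in>elts F. \<exists>u\<in>H. vpair x u \<in> elts g \<and> \<not> vpair y u \<in> elts g)) \<and>
     (\<forall>x\<in>elts K. \<exists>\<alpha>\<in>elts \<kappa>. \<exists>h\<in>H. \<forall>g\<in>elts F. \<not> vpair x z \<in> elts g \<longrightarrow>
        (\<exists>\<beta>\<in>elts \<alpha>. vpair \<beta> g \<in> elts h \<and> (\<forall>g'\<in>elts F. vpair \<beta> g' \<in> elts h \<longrightarrow> g' = g)))"

text \<open>Elementarity chooses first \<alpha> and then \<open>h\<close> in \<open>M\<close>. The
  index \<beta> of \<open>g\<close> belongs to \<alpha> and hence to \<open>M\<close> by stability,
  and \<open>g\<close> is definable from \<beta>, \<open>h\<close> and \<open>F\<close>.\<close>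

lemma corson_family_members_in_M:
  assumes P: "\<kappa> \<in> M" "K \<in> M" "F \<in> M" "z \<in> M" "corson_family L B K \<kappa> F z"
    and stable: "\<And>\<alpha>. \<alpha> \<in> elts \<kappa> \<inter> M \<Longrightarrow> elts \<alpha> \<subseteq> M"
    and x: "x \<in> elts K \<inter> M" and g: "g \<in> elts F" "vpair x z \<notin> elts g"
  shows "g \<in> M"
proof -
  have xM: "x \<in> M" using x by blast
  let ?R = "\<lambda>\<alpha> h. \<forall>g\<in>elts F. \<not> vpair x z \<in> elts g \<longrightarrow>
        (\<exists>\<beta>\<in>elts \<alpha>. vpair \<beta> g \<in> elts h \<and> (\<forall>g'\<in>elts F. vpair \<beta> g' \<in> elts h \<longrightarrow> g' = g))"
  have "\<exists>\<alpha>\<in>elts \<kappa>. \<exists>h\<in>H. ?R \<alpha> h" using P(5) x unfolding corson_family_def by blast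
  then obtain \<alpha>0 where \<alpha>0: "\<alpha>0 \<in> elts \<kappa> \<and> (\<exists>h\<in>H. ?R \<alpha>0 h)" by blast
  have "dfn (\<lambda>s. s 0 \<in> elts \<kappa> \<and> (\<exists>h\<in>H. ?R (s 0) h))"
    by (rule compound | rule definability | rule xM P)+
  from witness_in_M[OF this _ \<alpha>0] obtain \<alpha> where \<alpha>: "\<alpha> \<in> M" "\<alpha> \<in> elts \<kappa>" "\<exists>h\<in>H. ?R \<alpha> h"
    using Hset_mem[OF M_H[OF P(1)]] \<alpha>0 by blast
  then obtain h0 where h0: "h0 \<in> H" "?R \<alpha> h0" by blast
  have "dfn (\<lambda>s. ?R \<alpha> (s 0))"
    by (rule compound | rule definability | rule xM P \<alpha>)+
  from witness_in_M[OF this h0] obtain h where h: "h \<in> M" "?R \<alpha> h" by blast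
  then obtain \<beta> where \<beta>: "\<beta> \<in> elts \<alpha>" "vpair \<beta> g \<in> elts h"
    "\<And>g'. g' \<in> elts F \<Longrightarrow> vpair \<beta> g' \<in> elts h \<Longrightarrow> g' = g" using g by blast
  have \<beta>M: "\<beta> \<in> M" using stable[of \<alpha>] \<alpha> \<beta>(1) by blast
  show "g \<in> M"
  proof (rule unique_in_M)
    show "dfn (\<lambda>s. s 0 \<in> elts F \<and> vpair \<beta> (s 0) \<in> elts h)"
      by (rule compound | rule definability | rule \<beta>M P h)+
    show "g \<in> H" using Hset_mem[OF M_H[OF P(3)] g(1)] .
    show "g \<in> elts F \<and> vpair \<beta> g \<in> elts h" using g(1) \<beta>(2) by blast
    show "g' = g" if "g' \<in> elts F \<and> vpair \<beta> g' \<in> elts h" for g' using \<beta>(3) that by blast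
  qed
qed

end

lemma property_B_if_kappa_Corson:
  fixes \<kappa> K :: "'v::zfc_universe" and T :: "'v topology"
  assumes \<kappa>: "regular_cardinal \<kappa>" and T: "topspace T = elts K"
    and corson: "kappa_Corson \<kappa> T"
  shows "property_B \<kappa> K T"
proof -
  obtain S e where e: "embedding_map T (Sigma_space \<kappa> S) e"
    using corson unfolding kappa_Corson_def by blast
  then have hom: "homeomorphic_map T (subtopology (Sigma_space \<kappa> S) (e ` topspace T)) e"
    by (simp add: embedding_map_def)
  have e_cont: "continuous_map T (Sigma_space \<kappa> S) e"
    using homeomorphic_imp_continuous_map[OF hom] continuous_map_in_subtopology by blast
  have e_inj: "inj_on e (elts K)"
    using homeomorphic_imp_injective_map[OF hom] T by simp
  have e_prod: "continuous_map T (product_topology (\<lambda>_. top_of_set {0..1}) (elts S)) e"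
    using e_cont unfolding Sigma_space_def continuous_map_in_subtopology by blast
  have e_ext: "e x \<in> extensional (elts S)" if "x \<in> elts K" for x
    using e_prod that T unfolding continuous_map_componentwise by blast
  have f_cont: "continuous_map T euclideanreal (\<lambda>x. e x s)" if "s \<in> elts S" for s
    using e_prod that unfolding continuous_map_componentwise
    by (simp add: continuous_map_in_subtopology)
  have supp: "{s \<in> elts S. e x s \<noteq> 0} \<prec> elts \<kappa>" if "x \<in> elts K" for x
    using e_cont that T unfolding Sigma_space_def continuous_map_in_subtopology by auto
  \<comment> \<open>Of \<open>S\<close> only the size matters: the family consists of graphs on
    \<open>K\<close>, so it belongs to H(\<theta>) without \<open>S\<close> having to.\<close>
  let ?D = "elts S \<union> range (vreal :: real \<Rightarrow> 'v)"
  have "infinite (range (vreal :: real \<Rightarrow> 'v))"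
    using infinite_UNIV_char_0 by (simp add: finite_image_iff inj_on_def vreal_inject)
  then have "infinite ?D" by simp
  moreover have "?D \<in> range elts" by (intro is_set_Un is_set_elts is_set_range_vreal)
  ultimately obtain \<theta>\<^sub>0 :: 'v where \<theta>\<^sub>0: "regular_cardinal \<theta>\<^sub>0" "?D \<prec> elts \<theta>\<^sub>0"
    using regular_cardinal_above by blast
  show ?thesis unfolding property_B_def
  proof (intro exI[of _ \<theta>\<^sub>0] conjI allI impI ballI)
    show "cardinal \<theta>\<^sub>0" using \<theta>\<^sub>0(1) by (simp add: regular_cardinal_def)
  next
    fix \<theta> M x y
    assume "regular_cardinal \<theta> \<and> elts \<theta>\<^sub>0 \<subseteq> elts \<theta>"
      and "stable_submodel \<kappa> \<theta> M \<and> space_in_model K T M \<and> M \<prec> elts \<kappa>"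
    then have \<theta>: "regular_cardinal \<theta>" "elts \<theta>\<^sub>0 \<subseteq> elts \<theta>"
      and stable: "stable_submodel \<kappa> \<theta> M" and space: "space_in_model K T M" by auto
    assume x: "x \<in> T closure_of (elts K \<inter> M)" and y: "y \<in> T closure_of (elts K \<inter> M)" and "x \<noteq> y"
    have D: "Y \<prec> elts \<theta>" if "Y \<lesssim> ?D" for Y :: "'v set"
      using that \<theta>\<^sub>0(2) subset_imp_lepoll[OF \<theta>(2)] by (meson lesspoll_trans1 lesspoll_trans2)
    interpret submodel \<theta> M
    proof
      show "elementary_submodel M (Hset \<theta>)" using stable by (simp add: stable_submodel_def)
      show "range (vreal :: real \<Rightarrow> 'v) \<prec> elts \<theta>" by (intro D subset_imp_lepoll) simp
    qed (rule \<theta>(1))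
    have \<kappa>M: "\<kappa> \<in> M" and initial: "\<And>\<alpha>. \<alpha> \<in> elts \<kappa> \<inter> M \<Longrightarrow> elts \<alpha> \<subseteq> M"
      using stable by (auto simp: stable_submodel_def)
    obtain B where KM: "K \<in> M" and BM: "B \<in> M"
      and B: "openin T = arbitrary union_of (\<lambda>U. U \<in> elts ` elts B)"
      using space unfolding space_in_model_def by blast
    obtain L where LM: "L \<in> M" and L: "is_order L"
      using order_in_M unfolding is_order_def by blast
    have KH: "K \<in> H" by (rule M_H[OF KM])

    define f where "f s = (\<lambda>x. e x s)" for s
    define F where "F = vset ((\<lambda>s. vgraph K (f s)) ` elts S)"
    have FX: "(\<lambda>s. vgraph K (f s)) ` elts S \<subseteq> H" "(\<lambda>s. vgraph K (f s)) ` elts S \<prec> elts \<theta>"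
      using vgraph_H[OF KH] by (auto intro!: D lepoll_trans[OF image_lepoll subset_imp_lepoll])
    have FH: "F \<in> H" and F: "elts F = (\<lambda>s. vgraph K (f s)) ` elts S"
      unfolding F_def using H_vset[OF FX] by auto
    have "corson_family L B K \<kappa> F (vreal 0)"
      unfolding corson_family_def
    proof (intro conjI ballI)
      show "cont_graph L B K g" if "g \<in> elts F" for g
        using that cont_graph_vgraph[OF L T B f_cont] unfolding F f_def by blast
      show "a = b \<or> (\<exists>g\<in>elts F. \<exists>u\<in>H. vpair a u \<in> elts g \<and> vpair b u \<notin> elts g)"
        if ab: "a \<in> elts K" "b \<in> elts K" for a b
      proof (rule disjCI)
        assume ne: "\<not> (\<exists>g\<in>elts F. \<exists>u\<in>H. vpair a u \<in> elts g \<and> vpair b u \<notin> elts g)"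
        have "e a s = e b s" if "s \<in> elts S" for s
        proof -
          have "vpair a (vreal (f s a)) \<in> elts (vgraph K (f s))" using ab by (simp add: vpair_mem_vgraph)
          then have "vpair b (vreal (f s a)) \<in> elts (vgraph K (f s))"
            using ne that vreal_H unfolding F by blast
          then show ?thesis by (simp add: vpair_mem_vgraph vreal_inject f_def)
        qed
        then have "e a = e b" by (rule extensionalityI[OF e_ext[OF ab(1)] e_ext[OF ab(2)]])
        then show "a = b" using e_inj ab by (simp add: inj_on_def)
      qed
      fix a assume a: "a \<in> elts K"
      let ?Z = "{s \<in> elts S. e a s \<noteq> 0}"
      obtain \<alpha> where \<alpha>: "\<alpha> \<in> elts \<kappa>" "?Z \<lesssim> elts \<alpha>"
        using lesspoll_regular_bounded[OF \<kappa> supp[OF a]] by blast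
      then obtain j where j: "inj_on j ?Z" "j ` ?Z \<subseteq> elts \<alpha>" by (auto simp: lepoll_def)
      let ?h = "(\<lambda>s. vpair (j s) (vgraph K (f s))) ` ?Z"
      have "j s \<in> H" if "s \<in> ?Z" for s
        using Hset_mem[OF Hset_mem[OF M_H[OF \<kappa>M] \<alpha>(1)]] j(2) that by blast
      then have "?h \<subseteq> H" using vgraph_H[OF KH] by (auto intro!: vpair_H)
      moreover have "?h \<prec> elts \<theta>"
        by (intro D lepoll_trans[OF image_lepoll subset_imp_lepoll]) auto
      ultimately have h: "vset ?h \<in> H" "elts (vset ?h) = ?h" by (rule H_vset)+
      show "\<exists>\<alpha>\<in>elts \<kappa>. \<exists>h\<in>H. \<forall>g\<in>elts F. \<not> vpair a (vreal 0) \<in> elts g \<longrightarrow>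
        (\<exists>\<beta>\<in>elts \<alpha>. vpair \<beta> g \<in> elts h \<and> (\<forall>g'\<in>elts F. vpair \<beta> g' \<in> elts h \<longrightarrow> g' = g))"
      proof (intro bexI[OF _ \<alpha>(1)] bexI[OF _ h(1)] ballI impI)
        fix g assume g: "g \<in> elts F" "vpair a (vreal 0) \<notin> elts g"
        then obtain s where s: "s \<in> elts S" "g = vgraph K (f s)" unfolding F by blast
        have sZ: "s \<in> ?Z" using g(2) s a by (auto simp: vpair_mem_vgraph vreal_inject f_def)
        show "\<exists>\<beta>\<in>elts \<alpha>. vpair \<beta> g \<in> elts (vset ?h) \<and>
          (\<forall>g'\<in>elts F. vpair \<beta> g' \<in> elts (vset ?h) \<longrightarrow> g' = g)"
          unfolding h(2)
        proof (intro bexI[of _ "j s"] conjI ballI impI)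
          show "vpair (j s) g \<in> ?h" using sZ s(2) by blast
          show "j s \<in> elts \<alpha>" using sZ j(2) by blast
          fix g' assume "vpair (j s) g' \<in> ?h"
          then obtain s' where "s' \<in> ?Z" "j s = j s'" "g' = vgraph K (f s')"
            by (auto simp: vpair_inject)
          then show "g' = g" using inj_onD[OF j(1) _ sZ, of s'] s(2) by simp
        qed
      qed
    qed
    \<comment> \<open>The value \<open>vreal 0\<close> is quantified away: any common exceptional
      value works, so elementarity may supply another family and another value, both in
      \<open>M\<close>.\<close>
    then have ex: "\<exists>z\<in>H. corson_family L B K \<kappa> F z" using vreal_H by blast
    have "dfn (\<lambda>s. \<exists>z\<in>H. corson_family L B K \<kappa> (s 0) z)"
      unfolding corson_family_def
      by (rule compound | rule definability | rule LM BM KM \<kappa>M)+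
    from witness_in_M[OF this FH ex] obtain F' where F'M: "F' \<in> M"
      and "\<exists>z\<in>H. corson_family L B K \<kappa> F' z" by blast
    then obtain z0 where z0: "z0 \<in> H" "corson_family L B K \<kappa> F' z0" by blast
    have "dfn (\<lambda>s. corson_family L B K \<kappa> F' (s 0))"
      unfolding corson_family_def
      by (rule compound | rule definability | rule LM BM KM \<kappa>M F'M)+
    from witness_in_M[OF this z0] obtain z where zM: "z \<in> M"
      and fam: "corson_family L B K \<kappa> F' z" by blast

    have xy: "x \<in> elts K" "y \<in> elts K"
      using x y closure_of_subset_topspace[of T] T by blast+
    then obtain g u where g: "g \<in> elts F'" "vpair x u \<in> elts g" "vpair y u \<notin> elts g"
      using fam \<open>x \<noteq> y\<close> unfolding corson_family_def by blast
    have "cont_graph L B K g"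
      using fam[unfolded corson_family_def, THEN conjunct1] g(1) by (rule bspec)
    then obtain k where k: "continuous_map T euclideanreal k" "g = vgraph K k"
      using cont_graphD[OF L T B] by blast
    have kne: "k x \<noteq> k y" using g xy unfolding k(2) vpair_mem_vgraph by auto
    show "\<not> model_equiv K T M x y"
    proof
      assume "model_equiv K T M x y"
      then have "g \<notin> M" using k kne unfolding model_equiv_def by blast
      \<comment> \<open>If \<open>g\<close> were different from \<open>z\<close> at some point of
        \<open>K\<close> in \<open>M\<close>, it would belong to \<open>M\<close>. So it is constant
        there, and by continuity on the closure that contains \<open>x\<close> and
        \<open>y\<close>.\<close>
      then have z: "vreal (k w) = z" if "w \<in> elts K \<inter> M" for w
        using corson_family_members_in_M[OF \<kappa>M KM F'M zM fam initial that g(1)]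
        unfolding k(2) vpair_mem_vgraph by blast
      obtain w0 where w0: "w0 \<in> elts K \<inter> M" using x by (force simp: in_closure_of)
      have "k w = k w0" if "w \<in> elts K \<inter> M" for w
        using z[OF that] z[OF w0] by (metis vreal_inject)
      then have "elts K \<inter> M \<subseteq> {w \<in> topspace T. k w \<in> {k w0}}" using T by auto
      moreover have "closedin T {w \<in> topspace T. k w \<in> {k w0}}"
        by (rule closedin_continuous_map_preimage[OF k(1)]) simp
      ultimately have "T closure_of (elts K \<inter> M) \<subseteq> {w \<in> topspace T. k w \<in> {k w0}}"
        by (rule closure_of_minimal)
      then have "x \<in> {w \<in> topspace T. k w \<in> {k w0}}" "y \<in> {w \<in> topspace T. k w \<in> {k w0}}"
        using x y by blast+
      then show False using kne by simp
    qed
  qed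
qed

theorem theorem2p10:
  fixes \<kappa> K :: "'v::zfc_universe" and T :: "'v topology"
  assumes "regular_cardinal \<kappa>" and "uncountable (elts \<kappa>)"
    and "topspace T = elts K" and "compact_space T" and "Hausdorff_space T"
  shows "kappa_Corson \<kappa> T \<longleftrightarrow> property_B \<kappa> K T"
  using kappa_Corson_if_property_B[OF assms] property_B_if_kappa_Corson[OF assms(1,3)] by blast

end
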